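(* Let $b\in\mathscr{S}(n)$, $\alpha\in\mathcal{U}(n)$, $\lambda\in\mathbb{T}$, and let $E=\mathbf{E}_\alpha(\lambda)$. Then $b\alpha^*$ has a Carathéodory angular derivative at $\lambda$ on the subspace $E$, and for all $\mathbf{x},\mathbf{y}\in E$ $$\left(\operatorname{CAD}_E(b\alpha^* )(\lambda)\,\mathbf{x},\mathbf{y}\right)_{\mathbb{C}^n}=\left\langle k^b_{\lambda,\mathbf{x}},k^b_{\lambda,\mathbf{y}}\right\rangle_{\mathscr{H}(b)}.$$
   Context: $\mathbb{D}$ is the open unit disc and $\mathbb{T}=\partial\mathbb{D}$. $\mathscr{S}(n)$ is the set of bounded analytic $n\times n$ matrix-valued functions $b$ on $\mathbb{D}$ with $\|b(z)\|<1$ (operator norm) for all $z\in\mathbb{D}$. $\mathcal{U}(n)$ is the group of unitary $n\times n$ matrices. Inner products are linear in the first argument. The non-tangential ("n.t.") limit $z\to\lambda$ means the limit from within every Stolz region $\Gamma_t(\lambda)=\{z\in\mathbb{D}:|z-\lambda|<t(1-|z|)\}$, $t>1$. CAD: for a subspace $E\subset\mathbb{C}^n$ with orthogonal projection $P_E$, a function $f\in\mathscr{S}(n)$ has a Carathéodory angular derivative at $\lambda\in\mathbb{T}$ on $E$ if $\lim_{z\to\lambda\ \text{n.t.}}f(z)\mathbf{e}=\mathbf{e}$ for every $\mathbf{e}\in E$, and the limit $\operatorname{CAD}_E f(\lambda):=\lim_{z\to\lambda\ \text{n.t.}}P_E\,f'(z)\,P_E$ exists. Carathéodory condition: $b$ satisfies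 the Carathéodory condition in the codirection $\mathbf{x}\in\mathbb{C}^n$ at $\lambda$ if $$\liminf_{z\to\lambda\ \text{n.t.}}\frac{\|\mathbf{x}\|^2-\|b(z)^*\mathbf{x}\|^2}{1-|z|^2}<\infty,$$ i.e. there is a sequence $z_k\to\lambda$ contained in some Stolz region at $\lambda$ along which the quotient stays bounded. Directional sets: $$\mathbf{S}_\alpha(\lambda)=\Big\{\mathbf{e}\in\mathbb{C}^n:\lim_{z\to\lambda\ \text{n.t.}}b(z)^*\mathbf{e}=\alpha^*\mathbf{e}\Big\},$$ $$\mathbf{E}_\alpha(\lambda)=\{\mathbf{x}\in\mathbf{S}_\alpha(\lambda):b\text{ satisfies the Carathéodory condition at }\lambda\text{ in codirection }\mathbf{x}\};$$ $\mathbf{E}_\alpha(\lambda)$ is a subspace of $\mathbb{C}^n$. The de Branges--Rovnyak space $\mathscr{H}(b)$ is the range of $R_b=(I-T_bT_b^* )^{1/2}$ on $H^2(\mathbb{C}^n)$, where $T_bf=bf$, with the range norm $\|f\|_{\mathscr{H}(b)}=\inf\{\|h\|_{H^2(\mathbb{C}^n)}:R_bh=f\}$; equivalently, it is the $\mathbb{C}^n$-valued reproducing kernel Hilbert space on $\mathbb{D}$ with kernel $k^b(z,w)=\dfrac{I_n-b(z)b(w)^*}{1-z\overline w}$. Boundary reproducing kernel: if $b$ satisfies the Carathéodory condition at $\lambda$ in codirection $\mathbf{x}$, then the limit $b^*(\lambda,\mathbf{x}):=\lim_{z\to\lambda\ \text{n.t.}}b(z)^*\mathbf{x}$ exists, and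 the function $k^b_{\lambda,\mathbf{x}}(z):=\dfrac{\mathbf{x}-b(z)\,b^*(\lambda,\mathbf{x})}{1-z\overline\lambda}$ belongs to $\mathscr{H}(b)$.
   Formalization: The identity is proved with an extra factor λ on the left: λ(CAD_E(bα* )(λ)x, y) = ⟨k_{λ,x}, k_{λ,y}⟩; as printed it fails for λ ≠ 1, e.g. n = 1, b(z) = z times the conjugate of λ, α = 1. *)

theory Defs
  imports "HOL-Complex_Analysis.Complex_Analysis"
begin

section \<open>Linear algebra in \<open>complex ^ 'n\<close>\<close>

text \<open>The library's \<open>inner\<close> on \<open>complex ^ 'n\<close> is the real part of the following form.\<close>

definition cinner :: "complex ^ 'n \<Rightarrow> complex ^ 'n \<Rightarrow> complex" where
  "cinner x y = (\<Sum>i\<in>UNIV. x $ i * cnj (y $ i))"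

definition mat_adj :: "complex ^ 'n ^ 'm \<Rightarrow> complex ^ 'm ^ 'n" where
  "mat_adj A = (\<chi> i j. cnj (A $ j $ i))"

definition unitary_mat :: "complex ^ 'n ^ 'n \<Rightarrow> bool" where
  "unitary_mat A \<longleftrightarrow> mat_adj A ** A = mat 1 \<and> A ** mat_adj A = mat 1"

definition orth_proj :: "(complex ^ 'n) set \<Rightarrow> complex ^ 'n ^ 'n" where
  "orth_proj E = (THE P. P ** P = P \<and> mat_adj P = P \<and> range ((*v) P) = E)"


section \<open>The Schur class and non-tangential limits\<close>

text \<open>Functions on the open unit disc are represented by total functions on \<open>complex\<close>
  whose values outside \<open>ball 0 1\<close> are irrelevant.\<close>

definition schur_class :: "(complex \<Rightarrow> complex ^ 'n ^ 'n) set" where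
  "schur_class = {b. (\<forall>i j. (\<lambda>z. b z $ i $ j) holomorphic_on ball 0 1) \<and>
                     (\<forall>z\<in>ball 0 1. onorm ((*v) (b z)) < 1)}"

definition stolz :: "real \<Rightarrow> complex \<Rightarrow> complex set" where
  "stolz t \<zeta> = {z \<in> ball 0 1. cmod (z - \<zeta>) < t * (1 - cmod z)}"

text \<open>A property holds eventually for this filter iff it holds eventually within each single
  Stolz region. Hence \<open>(f \<longlongrightarrow> l) (at_nt \<zeta>)\<close> is convergence within every Stolz region, while a
  property holds frequently iff it does so within some Stolz region.\<close>

definition at_nt :: "complex \<Rightarrow> complex filter" where
  "at_nt \<zeta> = (SUP t\<in>{1<..}. at \<zeta> within stolz t \<zeta>)"


section \<open>Caratheodory angular derivatives\<close>

definition mat_deriv :: "(complex \<Rightarrow> complex ^ 'n ^ 'm) \<Rightarrow> complex \<Rightarrow> complex ^ 'n ^ 'm" where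
  "mat_deriv f z = (\<chi> i j. deriv (\<lambda>w. f w $ i $ j) z)"

definition CAD :: "(complex ^ 'n) set \<Rightarrow> (complex \<Rightarrow> complex ^ 'n ^ 'n) \<Rightarrow> complex \<Rightarrow> complex ^ 'n ^ 'n"
  where "CAD E f \<zeta> = Lim (at_nt \<zeta>) (\<lambda>z. orth_proj E ** mat_deriv f z ** orth_proj E)"

definition has_CAD :: "(complex ^ 'n) set \<Rightarrow> (complex \<Rightarrow> complex ^ 'n ^ 'n) \<Rightarrow> complex \<Rightarrow> bool" where
  "has_CAD E f \<zeta> \<longleftrightarrow>
     vec.subspace E \<and> f \<in> schur_class \<and>
     (\<forall>e\<in>E. ((\<lambda>z. f z *v e) \<longlongrightarrow> e) (at_nt \<zeta>)) \<and>
     (\<exists>L. ((\<lambda>z. orth_proj E ** mat_deriv f z ** orth_proj E) \<longlongrightarrow> L) (at_nt \<zeta>))"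


section \<open>Caratheodory condition and directional sets\<close>

definition caratheodory_cond ::
    "(complex \<Rightarrow> complex ^ 'n ^ 'n) \<Rightarrow> complex \<Rightarrow> complex ^ 'n \<Rightarrow> bool" where
  "caratheodory_cond b \<zeta> x \<longleftrightarrow>
     Liminf (at_nt \<zeta>)
       (\<lambda>z. ereal (((norm x)\<^sup>2 - (norm (mat_adj (b z) *v x))\<^sup>2) / (1 - (cmod z)\<^sup>2))) < \<infinity>"

definition dir_S ::
    "(complex \<Rightarrow> complex ^ 'n ^ 'n) \<Rightarrow> complex ^ 'n ^ 'n \<Rightarrow> complex \<Rightarrow> (complex ^ 'n) set" where
  "dir_S b \<alpha> \<zeta> = {e. ((\<lambda>z. mat_adj (b z) *v e) \<longlongrightarrow> mat_adj \<alpha> *v e) (at_nt \<zeta>)}"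

definition dir_E ::
    "(complex \<Rightarrow> complex ^ 'n ^ 'n) \<Rightarrow> complex ^ 'n ^ 'n \<Rightarrow> complex \<Rightarrow> (complex ^ 'n) set" where
  "dir_E b \<alpha> \<zeta> = {x \<in> dir_S b \<alpha> \<zeta>. caratheodory_cond b \<zeta> x}"


section \<open>The vector-valued Hardy space\<close>

definition taylor_coeff :: "(complex \<Rightarrow> complex ^ 'n) \<Rightarrow> nat \<Rightarrow> complex ^ 'n" where
  "taylor_coeff f k = (\<chi> i. (deriv ^^ k) (\<lambda>z. f z $ i) 0 / fact k)"

definition H2 :: "(complex \<Rightarrow> complex ^ 'n) set" where
  "H2 = {f. (\<forall>i. (\<lambda>z. f z $ i) holomorphic_on ball 0 1) \<and>
            summable (\<lambda>k. (norm (taylor_coeff f k))\<^sup>2)}"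

definition H2_inner :: "(complex \<Rightarrow> complex ^ 'n) \<Rightarrow> (complex \<Rightarrow> complex ^ 'n) \<Rightarrow> complex" where
  "H2_inner f g = (\<Sum>k. cinner (taylor_coeff f k) (taylor_coeff g k))"

definition H2_norm :: "(complex \<Rightarrow> complex ^ 'n) \<Rightarrow> real" where
  "H2_norm f = sqrt (\<Sum>k. (norm (taylor_coeff f k))\<^sup>2)"

definition eq_on_disc :: "(complex \<Rightarrow> complex ^ 'n) \<Rightarrow> (complex \<Rightarrow> complex ^ 'n) \<Rightarrow> bool" where
  "eq_on_disc f g \<longleftrightarrow> (\<forall>z\<in>ball 0 1. f z = g z)"

definition H2_operator ::
    "((complex \<Rightarrow> complex ^ 'n) \<Rightarrow> (complex \<Rightarrow> complex ^ 'n)) \<Rightarrow> bool" where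
  "H2_operator T \<longleftrightarrow>
     (\<forall>f\<in>H2. T f \<in> H2) \<and>
     (\<forall>f\<in>H2. \<forall>g\<in>H2. \<forall>c. eq_on_disc (T (\<lambda>z. c *s f z + g z)) (\<lambda>z. c *s T f z + T g z)) \<and>
     (\<exists>C. \<forall>f\<in>H2. H2_norm (T f) \<le> C * H2_norm f)"

text \<open>The operators chosen below are unique up to the irrelevant values outside the disc.\<close>

definition H2_adjoint ::
    "((complex \<Rightarrow> complex ^ 'n) \<Rightarrow> (complex \<Rightarrow> complex ^ 'n)) \<Rightarrow>
     (complex \<Rightarrow> complex ^ 'n) \<Rightarrow> (complex \<Rightarrow> complex ^ 'n)" where
  "H2_adjoint T =
     (SOME S. H2_operator S \<and> (\<forall>f\<in>H2. \<forall>g\<in>H2. H2_inner (T f) g = H2_inner f (S g)))"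

definition H2_sqrt ::
    "((complex \<Rightarrow> complex ^ 'n) \<Rightarrow> (complex \<Rightarrow> complex ^ 'n)) \<Rightarrow>
     (complex \<Rightarrow> complex ^ 'n) \<Rightarrow> (complex \<Rightarrow> complex ^ 'n)" where
  "H2_sqrt A =
     (SOME R. H2_operator R \<and>
        (\<forall>f\<in>H2. \<forall>g\<in>H2. H2_inner (R f) g = H2_inner f (R g)) \<and>
        (\<forall>f\<in>H2. 0 \<le> Re (H2_inner (R f) f)) \<and>
        (\<forall>f\<in>H2. eq_on_disc (R (R f)) (A f)))"


section \<open>The de Branges--Rovnyak space\<close>

definition mult_op ::
    "(complex \<Rightarrow> complex ^ 'n ^ 'n) \<Rightarrow> (complex \<Rightarrow> complex ^ 'n) \<Rightarrow> (complex \<Rightarrow> complex ^ 'n)" where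
  "mult_op b f = (\<lambda>z. b z *v f z)"

definition dBR_op ::
    "(complex \<Rightarrow> complex ^ 'n ^ 'n) \<Rightarrow> (complex \<Rightarrow> complex ^ 'n) \<Rightarrow> (complex \<Rightarrow> complex ^ 'n)" where
  "dBR_op b = H2_sqrt (\<lambda>f z. f z - mult_op b (H2_adjoint (mult_op b) f) z)"

definition dBR_preimages ::
    "(complex \<Rightarrow> complex ^ 'n ^ 'n) \<Rightarrow> (complex \<Rightarrow> complex ^ 'n) \<Rightarrow> (complex \<Rightarrow> complex ^ 'n) set"
  where "dBR_preimages b f = {h \<in> H2. eq_on_disc (dBR_op b h) f}"

definition dBR_space :: "(complex \<Rightarrow> complex ^ 'n ^ 'n) \<Rightarrow> (complex \<Rightarrow> complex ^ 'n) set" where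
  "dBR_space b = {f. dBR_preimages b f \<noteq> {}}"

text \<open>The range norm, and the inner product that it induces by polarization; both are meaningful
  on \<open>dBR_space b\<close> only.\<close>

definition dBR_norm :: "(complex \<Rightarrow> complex ^ 'n ^ 'n) \<Rightarrow> (complex \<Rightarrow> complex ^ 'n) \<Rightarrow> real" where
  "dBR_norm b f = Inf (H2_norm ` dBR_preimages b f)"

definition dBR_inner ::
    "(complex \<Rightarrow> complex ^ 'n ^ 'n) \<Rightarrow> (complex \<Rightarrow> complex ^ 'n) \<Rightarrow> (complex \<Rightarrow> complex ^ 'n) \<Rightarrow> complex"
  where
  "dBR_inner b f g =
     (\<Sum>k<4. \<i> ^ k * of_real ((dBR_norm b (\<lambda>z. f z + \<i> ^ k *s g z))\<^sup>2)) / 4"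

definition bdry_adj ::
    "(complex \<Rightarrow> complex ^ 'n ^ 'n) \<Rightarrow> complex \<Rightarrow> complex ^ 'n \<Rightarrow> complex ^ 'n" where
  "bdry_adj b \<zeta> x = Lim (at_nt \<zeta>) (\<lambda>z. mat_adj (b z) *v x)"

definition bdry_kernel ::
    "(complex \<Rightarrow> complex ^ 'n ^ 'n) \<Rightarrow> complex \<Rightarrow> complex ^ 'n \<Rightarrow> complex \<Rightarrow> complex ^ 'n" where
  "bdry_kernel b \<zeta> x = (\<lambda>z. inverse (1 - z * cnj \<zeta>) *s (x - b z *v bdry_adj b \<zeta> x))"

text \<open>\<open>CAD\<close> is the derivative in \<open>z\<close>, not in the argument of \<open>z\<close>. Since
  \<open>1 - z * cnj \<zeta> = - cnj \<zeta> * (z - \<zeta>)\<close> for \<open>\<zeta>\<close> on the unit circle, the inner product of two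
  boundary kernels is \<open>\<zeta>\<close> times the form given by \<open>CAD\<close>. For example, \<open>b z = mat (cnj \<zeta> * z)\<close>
  has \<open>CAD\<close> equal to \<open>mat (cnj \<zeta>)\<close>, whereas its boundary kernels are constants \<open>x\<close>
  with the inner product of \<open>complex ^ 'n\<close>.\<close>

end

theory Submission
  imports Defs
begin

text \<open>Let \<open>R\<close> be the positive square root of \<open>I - T\<^sub>b T\<^sub>b\<^sup>*\<close> and \<open>g z x = R (k z x)\<close>, where \<open>k z x\<close>
  is the Szego kernel, so that \<open>R (g z x)\<close> is the reproducing kernel of \<open>\<H>(b)\<close>. The Caratheodory
  condition bounds \<open>g z x\<close> along a sequence \<open>z \<longlonglongrightarrow> \<zeta>\<close>; a common point \<open>h\<close> of the closed convex hulls of its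
  tails satisfies \<open>R h =\<close> boundary kernel and is orthogonal to the kernel of \<open>R\<close>, so norms in
  \<open>\<H>(b)\<close> can be computed with \<open>h\<close>. Conversely \<open>h\<close> controls
  \<open>g z x\<close> in every Stolz region (Julia's inequality), so \<open>g z x\<close> tends weakly to \<open>h\<close>
  non-tangentially. Pairing with the vector of another direction \<open>y\<close> gives the limit of
  \<open>\<langle>x - b(z)\<alpha>\<^sup>*x, y\<rangle> / (1 - z cnj \<zeta>)\<close>, and Cauchy's estimate turns this into the limit of the
  derivative.\<close>

section \<open>The Hilbert space of square-summable sequences\<close>

text \<open>Elements of \<open>H2\<close> are total functions that matter only on the disc, so the
  Hilbert space arguments run on their Taylor coefficients, which form a genuine type. This type is
  handled as a real Hilbert space: complex scalars act through the operator \<open>cscale\<close>,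
  and imaginary parts of inner products come from pairing with \<open>cscale \<i>\<close>. The
  adjoint and the square root are choices by \<open>SOME\<close>, so a witness must be built before
  anything is known about them. The obstacle at the boundary is that the Caratheodory condition is a
  liminf: it gives a bound along one sequence, and that sequence depends on the direction. The
  detour through \<open>h\<close> removes this dependence. Unitarity of \<alpha> enters here: the
  boundary value of \<open>b(z)^* x\<close> has the norm of \<open>x\<close>, so the defect of
  \<open>x\<close> at the boundary vanishes and Julia's inequality yields a bound in the whole Stolz
  region. The same bound makes \<open>dir_E\<close> closed under addition.\<close>

typedef (overloaded) 'a ell2 = "{a :: nat \<Rightarrow> 'a::real_inner. summable (\<lambda>k. (norm (a k))\<^sup>2)}"
  by (rule exI[of _ "\<lambda>_. 0"]) simp

setup_lifting type_definition_ell2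

lemma summable_Rep_ell2: "summable (\<lambda>k. (norm (Rep_ell2 a k))\<^sup>2)"
  using Rep_ell2 by auto

lemma ell2_eqI: "(\<And>k. Rep_ell2 a k = Rep_ell2 b k) \<Longrightarrow> a = b"
  by (metis Rep_ell2_inject ext)

lemma power2_norm_add_le: "(norm (x + y))\<^sup>2 \<le> 2 * (norm x)\<^sup>2 + 2 * (norm y)\<^sup>2"
  for x y :: "'a::real_inner"
proof -
  have "(norm (x + y))\<^sup>2 + (norm (x - y))\<^sup>2 = 2 * (norm x)\<^sup>2 + 2 * (norm y)\<^sup>2"
    by (simp add: power2_norm_eq_inner algebra_simps inner_commute)
  then show ?thesis by (smt (verit) zero_le_power2)
qed

lemma summable_norm2_add:
  fixes a b :: "nat \<Rightarrow> 'a::real_inner"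
  assumes "summable (\<lambda>k. (norm (a k))\<^sup>2)" "summable (\<lambda>k. (norm (b k))\<^sup>2)"
  shows "summable (\<lambda>k. (norm (a k + b k))\<^sup>2)"
proof (rule summable_comparison_test')
  show "summable (\<lambda>k. 2 * (norm (a k))\<^sup>2 + 2 * (norm (b k))\<^sup>2)"
    by (intro summable_add summable_mult assms)
qed (simp add: power2_norm_add_le)

lemma summable_norm2_scale:
  fixes a :: "nat \<Rightarrow> 'a::real_inner"
  assumes "summable (\<lambda>k. (norm (a k))\<^sup>2)"
  shows "summable (\<lambda>k. (norm (c *\<^sub>R a k))\<^sup>2)"
  using summable_mult[OF assms, of "c\<^sup>2"] by (simp add: power_mult_distrib)

lemma summable_inner:
  fixes a b :: "nat \<Rightarrow> 'a::real_inner"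
  assumes "summable (\<lambda>k. (norm (a k))\<^sup>2)" "summable (\<lambda>k. (norm (b k))\<^sup>2)"
  shows "summable (\<lambda>k. inner (a k) (b k))"
proof (rule summable_comparison_test')
  show "summable (\<lambda>k. (norm (a k))\<^sup>2 + (norm (b k))\<^sup>2)"
    by (intro summable_add assms)
  show "norm (inner (a k) (b k)) \<le> (norm (a k))\<^sup>2 + (norm (b k))\<^sup>2" for k
  proof -
    have "\<bar>inner (a k) (b k)\<bar> \<le> norm (a k) * norm (b k)"
      by (rule Cauchy_Schwarz_ineq2)
    also have "\<dots> \<le> (norm (a k))\<^sup>2 + (norm (b k))\<^sup>2"
      using sum_squares_bound[of "norm (a k)" "norm (b k)"]
        mult_nonneg_nonneg[OF norm_ge_zero[of "a k"] norm_ge_zero[of "b k"]] by linarith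
    finally show ?thesis by simp
  qed
qed

instantiation ell2 :: (real_inner) real_inner
begin

lift_definition zero_ell2 :: "'a ell2" is "\<lambda>_. 0" by simp
lift_definition plus_ell2 :: "'a ell2 \<Rightarrow> 'a ell2 \<Rightarrow> 'a ell2" is "\<lambda>a b k. a k + b k"
  by (simp add: summable_norm2_add)
lift_definition uminus_ell2 :: "'a ell2 \<Rightarrow> 'a ell2" is "\<lambda>a k. - a k" by simp
lift_definition minus_ell2 :: "'a ell2 \<Rightarrow> 'a ell2 \<Rightarrow> 'a ell2" is "\<lambda>a b k. a k - b k"
  using summable_norm2_add[where b = "\<lambda>k. - b k" for b] by fastforce
lift_definition scaleR_ell2 :: "real \<Rightarrow> 'a ell2 \<Rightarrow> 'a ell2" is "\<lambda>c a k. c *\<^sub>R a k"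
  by (simp only: mem_Collect_eq summable_norm2_scale)
lift_definition inner_ell2 :: "'a ell2 \<Rightarrow> 'a ell2 \<Rightarrow> real" is "\<lambda>a b. \<Sum>k. inner (a k) (b k)" .

definition norm_ell2 :: "'a ell2 \<Rightarrow> real" where "norm_ell2 a = sqrt (inner a a)"
definition sgn_ell2 :: "'a ell2 \<Rightarrow> 'a ell2" where "sgn_ell2 a = inverse (norm a) *\<^sub>R a"
definition dist_ell2 :: "'a ell2 \<Rightarrow> 'a ell2 \<Rightarrow> real" where "dist_ell2 a b = norm (a - b)"
definition uniformity_ell2 :: "('a ell2 \<times> 'a ell2) filter"
  where "uniformity_ell2 = (INF e\<in>{0<..}. principal {(x, y). dist x y < e})"
definition open_ell2 :: "'a ell2 set \<Rightarrow> bool"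
  where "open_ell2 U = (\<forall>x\<in>U. eventually (\<lambda>(x', y). x' = x \<longrightarrow> y \<in> U) uniformity)"

instance
proof
  fix a b c :: "'a ell2" and r s :: real
  show "a + b + c = a + (b + c)" by transfer (simp add: add.assoc)
  show "a + b = b + a" by transfer (simp add: add.commute)
  show "0 + a = a" by transfer simp
  show "- a + a = 0" by transfer simp
  show "a - b = a + - b" by transfer simp
  show "r *\<^sub>R (a + b) = r *\<^sub>R a + r *\<^sub>R b" by transfer (simp add: scaleR_add_right)
  show "(r + s) *\<^sub>R a = r *\<^sub>R a + s *\<^sub>R a" by transfer (simp add: scaleR_add_left)
  show "r *\<^sub>R s *\<^sub>R a = (r * s) *\<^sub>R a" by transfer simp
  show "1 *\<^sub>R a = a" by transfer simp
  show "inner a b = inner b a" by transfer (simp add: inner_commute)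
  show "inner (a + b) c = inner a c + inner b c"
    by transfer (simp add: inner_add_left suminf_add summable_inner)
  show "inner (r *\<^sub>R a) b = r * inner a b"
    by transfer (simp add: suminf_mult summable_inner)
  show "0 \<le> inner a a"
    by transfer (simp add: suminf_nonneg summable_inner)
  show "inner a a = 0 \<longleftrightarrow> a = 0"
  proof -
    have "summable (\<lambda>k. inner (Rep_ell2 a k) (Rep_ell2 a k))"
      by (intro summable_inner summable_Rep_ell2)
    then have "inner a a = 0 \<longleftrightarrow> (\<forall>k. Rep_ell2 a k = 0)"
      unfolding inner_ell2.rep_eq by (subst suminf_eq_zero_iff) auto
    then show ?thesis
      by (metis ell2_eqI zero_ell2.rep_eq)
  qed
qed (simp_all only: norm_ell2_def sgn_ell2_def dist_ell2_def uniformity_ell2_def open_ell2_def)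

end

lemma norm_ell2_sq: "(norm a)\<^sup>2 = (\<Sum>k. (norm (Rep_ell2 a k))\<^sup>2)"
  by (simp only: power2_norm_eq_inner inner_ell2.rep_eq)

lemma sum_norm2_Rep_le: "(\<Sum>k<N. (norm (Rep_ell2 a k))\<^sup>2) \<le> (norm a)\<^sup>2"
  unfolding norm_ell2_sq by (rule sum_le_suminf) (auto simp: summable_Rep_ell2)

lemma norm_Rep_ell2_le: "norm (Rep_ell2 a k) \<le> norm a"
proof -
  have "(norm (Rep_ell2 a k))\<^sup>2 \<le> (\<Sum>k<Suc k. (norm (Rep_ell2 a k))\<^sup>2)"
    by (simp add: sum_nonneg)
  also have "\<dots> \<le> (norm a)\<^sup>2" by (rule sum_norm2_Rep_le)
  finally show ?thesis by (rule power2_le_imp_le) simp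
qed

lemma summable_norm2_bounded:
  fixes c :: "nat \<Rightarrow> 'a::real_inner"
  assumes "\<And>N. (\<Sum>k<N. (norm (c k))\<^sup>2) \<le> C"
  shows "summable (\<lambda>k. (norm (c k))\<^sup>2)" "(\<Sum>k. (norm (c k))\<^sup>2) \<le> C"
proof -
  show "summable (\<lambda>k. (norm (c k))\<^sup>2)"
    by (rule summableI_nonneg_bounded[of _ C]) (use assms in auto)
  then show "(\<Sum>k. (norm (c k))\<^sup>2) \<le> C"
    using assms suminf_le_const by blast
qed

text \<open>Coordinates are contractions, so a Cauchy sequence has coordinatewise limits. The Cauchy
  estimate is kept on finite sums, where the limit can be taken term by term, and only afterwards is
  the number of terms released.\<close>

instance ell2 :: ("{real_inner,complete_space}") complete_space
proof
  fix X :: "nat \<Rightarrow> 'a ell2"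
  assume X: "Cauchy X"
  have "Cauchy (\<lambda>n. Rep_ell2 (X n) k)" for k
  proof (rule CauchyI)
    fix e :: real assume "e > 0"
    then obtain M where "\<And>m n. m \<ge> M \<Longrightarrow> n \<ge> M \<Longrightarrow> norm (X m - X n) < e"
      using CauchyD[OF X] by blast
    moreover have "norm (Rep_ell2 (X m) k - Rep_ell2 (X n) k) \<le> norm (X m - X n)" for m n
      using norm_Rep_ell2_le[of "X m - X n" k] by (simp add: minus_ell2.rep_eq)
    ultimately show "\<exists>M. \<forall>m\<ge>M. \<forall>n\<ge>M. norm (Rep_ell2 (X m) k - Rep_ell2 (X n) k) < e"
      by (meson le_less_trans)
  qed
  then have "\<forall>k. \<exists>l. (\<lambda>n. Rep_ell2 (X n) k) \<longlonglongrightarrow> l"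
    using Cauchy_convergent convergent_def by blast
  then obtain c where c: "\<And>k. (\<lambda>n. Rep_ell2 (X n) k) \<longlonglongrightarrow> c k" by metis
  have tail: "(\<Sum>k<N. (norm (Rep_ell2 (X m) k - c k))\<^sup>2) \<le> e\<^sup>2"
    if "\<And>n. n \<ge> M \<Longrightarrow> norm (X m - X n) \<le> e" for m M N e
  proof (rule tendsto_upperbound)
    show "(\<lambda>n. \<Sum>k<N. (norm (Rep_ell2 (X m) k - Rep_ell2 (X n) k))\<^sup>2)
        \<longlonglongrightarrow> (\<Sum>k<N. (norm (Rep_ell2 (X m) k - c k))\<^sup>2)"
      by (intro tendsto_intros c)
    have "(\<Sum>k<N. (norm (Rep_ell2 (X m) k - Rep_ell2 (X n) k))\<^sup>2) \<le> e\<^sup>2" if "n \<ge> M" for n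
      using sum_norm2_Rep_le[where N = N and a = "X m - X n"] power_mono[OF \<open>\<And>n. n \<ge> M \<Longrightarrow> _\<close>[OF that], of 2]
      by (simp add: minus_ell2.rep_eq)
    then show "\<forall>\<^sub>F n in sequentially. (\<Sum>k<N. (norm (Rep_ell2 (X m) k - Rep_ell2 (X n) k))\<^sup>2) \<le> e\<^sup>2"
      using eventually_sequentially by blast
  qed simp
  obtain M1 where "\<And>m n. m \<ge> M1 \<Longrightarrow> n \<ge> M1 \<Longrightarrow> norm (X m - X n) < 1"
    using CauchyD[OF X, of 1] by auto
  then have "summable (\<lambda>k. (norm (Rep_ell2 (X M1) k - c k))\<^sup>2)"
    by (intro summable_norm2_bounded(1)[where C = "1\<^sup>2"] tail[of M1]) (simp add: less_imp_le)
  \<comment> \<open>Adding \<open>- X M1\<close> to \<open>X M1 - c\<close> leaves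
    \<open>- c\<close>, which has the norms of \<open>c\<close>.\<close>
  from summable_norm2_add[OF this summable_norm2_scale[OF summable_Rep_ell2, of "-1" "X M1"]]
  have "summable (\<lambda>k. (norm (c k))\<^sup>2)" by (simp add: norm_minus_commute)
  then have Rc: "Rep_ell2 (Abs_ell2 c) = c" by (simp add: Abs_ell2_inverse)
  have "X \<longlonglongrightarrow> Abs_ell2 c"
  proof (rule LIMSEQ_I)
    fix e :: real assume e: "e > 0"
    obtain M where M: "\<And>m n. m \<ge> M \<Longrightarrow> n \<ge> M \<Longrightarrow> norm (X m - X n) < e / 2"
      using CauchyD[OF X, of "e / 2"] e by auto
    have "norm (X m - Abs_ell2 c) < e" if "m \<ge> M" for m
    proof -
      have "(norm (X m - Abs_ell2 c))\<^sup>2 \<le> (e / 2)\<^sup>2"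
        unfolding norm_ell2_sq minus_ell2.rep_eq Rc
        by (intro summable_norm2_bounded(2) tail[of M]) (use M that in \<open>simp add: less_imp_le\<close>)
      then have "norm (X m - Abs_ell2 c) \<le> e / 2" using e by (simp add: power2_le_iff_abs_le)
      then show ?thesis using e by linarith
    qed
    then show "\<exists>no. \<forall>n\<ge>no. norm (X n - Abs_ell2 c) < e" by blast
  qed
  then show "convergent X" by (auto simp: convergent_def)
qed

instance ell2 :: ("{real_inner,complete_space}") banach ..

section \<open>Adjoints, square roots and weak limits in real Hilbert spaces\<close>

text \<open>By the parallelogram law, almost minimal-norm elements of the sets form a Cauchy sequence.\<close>

lemma decreasing_closed_convex_inter_nonempty:
  fixes C :: "nat \<Rightarrow> 'a::{real_inner,complete_space} set"
  assumes cl: "\<And>m. closed (C m)" and cv: "\<And>m. convex (C m)"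
    and mono: "\<And>m n. m \<le> n \<Longrightarrow> C n \<subseteq> C m"
    and bd: "\<And>m. \<exists>x\<in>C m. norm x \<le> B"
  shows "\<exists>x. \<forall>m. x \<in> C m"
proof -
  define d where "d m = Inf ((\<lambda>x. (norm x)\<^sup>2) ` C m)" for m
  have ne: "C m \<noteq> {}" for m using bd[of m] by auto
  have bb: "bdd_below ((\<lambda>x. (norm x)\<^sup>2) ` C m)" for m
    by (rule bdd_belowI[of _ 0]) auto
  have d_le: "d m \<le> (norm x)\<^sup>2" if "x \<in> C m" for m x
    unfolding d_def by (rule cInf_lower) (use that bb in auto)
  have incd: "incseq d"
    unfolding d_def by (intro incseq_SucI cInf_superset_mono image_mono mono bb) (use ne in auto)
  have d_le_B: "d m \<le> B\<^sup>2" for m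
  proof -
    obtain x where x: "x \<in> C m" "norm x \<le> B" using bd by blast
    then show ?thesis using d_le[OF x(1)] power_mono[OF x(2), of 2] by simp
  qed
  then obtain D where D: "d \<longlonglongrightarrow> D"
    using incseq_convergent[OF incd] by blast
  have dD: "d m \<le> D" for m using incseq_le[OF incd D] .
  have "\<exists>x\<in>C m. (norm x)\<^sup>2 < d m + inverse (real (Suc m))" for m
    using cInf_lessD[of "(\<lambda>x. (norm x)\<^sup>2) ` C m" "d m + inverse (real (Suc m))"] ne[of m]
    by (auto simp: d_def)
  then obtain u where u: "\<And>m. u m \<in> C m" "\<And>m. (norm (u m))\<^sup>2 < d m + inverse (real (Suc m))"
    by metis
  \<comment> \<open>For \<open>m \<le> n\<close> the midpoint of \<open>u m\<close> and
    \<open>u n\<close> lies in the larger set \<open>C m\<close>, so its squared norm is at least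
    \<open>d m\<close>; both endpoints have squared norm below
    \<open>D + inverse (real (Suc m))\<close>.\<close>
  have est: "(norm (u m - u n))\<^sup>2 \<le> 4 * (D + inverse (real (Suc m)) - d m)" if "m \<le> n" for m n
  proof -
    have "(1/2) *\<^sub>R u m + (1/2) *\<^sub>R u n \<in> C m"
      using cv[of m] u(1)[of m] u(1)[of n] mono[OF that] by (intro convexD) auto
    then have "d m \<le> (norm ((1/2) *\<^sub>R u m + (1/2) *\<^sub>R u n))\<^sup>2" by (rule d_le)
    also have "\<dots> = (norm (u m + u n))\<^sup>2 / 4"
      by (simp add: scaleR_add_right[symmetric] power_mult_distrib power2_eq_square del: scaleR_add_right)
    finally have "4 * d m \<le> (norm (u m + u n))\<^sup>2" by simp
    moreover have "(norm (u m - u n))\<^sup>2 = 2 * (norm (u m))\<^sup>2 + 2 * (norm (u n))\<^sup>2 - (norm (u m + u n))\<^sup>2"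
      by (simp add: power2_norm_eq_inner algebra_simps inner_commute)
    moreover have "inverse (real (Suc n)) \<le> inverse (real (Suc m))"
      using that by (intro le_imp_inverse_le) auto
    ultimately show ?thesis using u(2)[of m] u(2)[of n] dD[of m] dD[of n] by argo
  qed
  have lim0: "(\<lambda>m. 4 * (D + inverse (real (Suc m)) - d m)) \<longlonglongrightarrow> 4 * (D + 0 - D)"
    by (intro tendsto_intros D LIMSEQ_inverse_real_of_nat)
  have "Cauchy u"
  proof (rule metric_CauchyI)
    fix e :: real assume e: "e > 0"
    then have "\<forall>\<^sub>F m in sequentially. 4 * (D + inverse (real (Suc m)) - d m) < (e/2)\<^sup>2"
      using lim0 by (intro order_tendstoD(2)[OF lim0]) auto
    then obtain M where M: "4 * (D + inverse (real (Suc M)) - d M) < (e/2)\<^sup>2"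
      by (auto simp: eventually_sequentially)
    have "dist (u M) (u n) < e / 2" if "n \<ge> M" for n
    proof -
      have "(norm (u M - u n))\<^sup>2 < (e/2)\<^sup>2" using est[OF that] M by linarith
      then show ?thesis
        unfolding dist_norm by (rule power2_less_imp_less) (use e in simp)
    qed
    then show "\<exists>M. \<forall>m\<ge>M. \<forall>n\<ge>M. dist (u m) (u n) < e"
      using dist_triangle_half_r by blast
  qed
  then obtain x where x: "u \<longlonglongrightarrow> x" using Cauchy_convergent convergent_def by blast
  have "x \<in> C m" for m
  proof (rule Lim_in_closed_set[OF cl _ _ x])
    show "\<forall>\<^sub>F n in sequentially. u n \<in> C m"
      using u(1) mono by (intro eventually_sequentiallyI[of m]) blast
  qed simp
  then show ?thesis by blast
qed

text \<open>Cutting \<open>S\<close> with closed balls whose radii decrease to the infimum of the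
  norms gives nested nonempty closed convex sets; a common point attains the infimum.\<close>

lemma min_norm_exists:
  fixes S :: "'a::{real_inner,complete_space} set"
  assumes "closed S" "convex S" "S \<noteq> {}"
  obtains x where "x \<in> S" "\<And>y. y \<in> S \<Longrightarrow> norm x \<le> norm y"
proof -
  define d where "d = Inf (norm ` S)"
  have d_le: "d \<le> norm y" if "y \<in> S" for y
    unfolding d_def by (rule cInf_lower) (use that in \<open>auto intro: bdd_belowI[of _ 0]\<close>)
  have ex: "\<exists>x\<in>S. norm x < d + inverse (real (Suc m))" for m
    using cInf_lessD[of "norm ` S" "d + inverse (real (Suc m))"] assms(3) by (auto simp: d_def)
  define C where "C m = S \<inter> cball 0 (d + inverse (real (Suc m)))" for m
  have "\<exists>x. \<forall>m. x \<in> C m"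
  proof (rule decreasing_closed_convex_inter_nonempty)
    show "closed (C m)" "convex (C m)" for m
      using assms by (auto simp: C_def intro: closed_Int convex_Int)
    show "C n \<subseteq> C m" if "m \<le> n" for m n
    proof -
      have "inverse (real (Suc n)) \<le> inverse (real (Suc m))"
        using that by (intro le_imp_inverse_le) auto
      then show ?thesis unfolding C_def by (intro Int_mono order_refl subset_cball) simp
    qed
    show "\<exists>x\<in>C m. norm x \<le> d + 1" for m
    proof -
      obtain x where x: "x \<in> S" "norm x < d + inverse (real (Suc m))" using ex by blast
      moreover have "inverse (real (Suc m)) \<le> 1" by (simp add: field_simps)
      ultimately show ?thesis by (intro bexI[of _ x]) (auto simp: C_def)
    qed
  qed
  then obtain x where x: "\<And>m. x \<in> C m" by blast
  have "norm x \<le> d + 0"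
  proof (rule LIMSEQ_le_const)
    show "(\<lambda>m. d + inverse (real (Suc m))) \<longlonglongrightarrow> d + 0"
      by (intro tendsto_intros LIMSEQ_inverse_real_of_nat)
  qed (use x in \<open>auto simp: C_def\<close>)
  with d_le x that show thesis by (force simp: C_def)
qed

text \<open>The point \<open>u\<close> of minimal norm on the affine hyperplane where the functional
  is 1 is orthogonal to its kernel, and every \<open>x\<close> differs from a multiple of
  \<open>u\<close> by a kernel element.\<close>

lemma riesz_representation:
  fixes \<phi> :: "'a::{real_inner,complete_space} \<Rightarrow> real"
  assumes "bounded_linear \<phi>"
  obtains v where "\<And>x. \<phi> x = inner v x"
proof (cases "\<forall>x. \<phi> x = 0")
  case True
  then show thesis using that[of 0] by simp
next
  case False
  interpret \<phi>: bounded_linear \<phi> by fact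
  from False obtain x0 where x0: "\<phi> x0 \<noteq> 0" by blast
  define S where "S = {x. \<phi> x = 1}"
  have "closed S" unfolding S_def
    by (intro closed_Collect_eq continuous_on_const linear_continuous_on assms)
  moreover have "convex S"
    by (auto simp: S_def convex_def \<phi>.add \<phi>.scaleR)
  moreover have "x0 /\<^sub>R \<phi> x0 \<in> S" using x0 by (simp add: S_def \<phi>.scaleR)
  ultimately obtain u where u: "u \<in> S" "\<And>y. y \<in> S \<Longrightarrow> norm u \<le> norm y"
    using min_norm_exists[of S] by blast
  have orth: "inner u d = 0" if "\<phi> d = 0" for d
  proof (rule ccontr)
    assume ne: "inner u d \<noteq> 0"
    then have d: "inner d d > 0" by (metis inner_zero_right inner_gt_zero_iff)
    \<comment> \<open>This \<open>t\<close> minimises the quadratic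
      \<open>(norm (u + t *\<^sub>R d))\<^sup>2\<close>, so a nonzero \<open>inner u d\<close> would
      contradict minimality of \<open>u\<close>.\<close>
    define t where "t = - inner u d / inner d d"
    have "u + t *\<^sub>R d \<in> S" using u(1) that by (simp add: S_def \<phi>.add \<phi>.scaleR)
    then have "(norm u)\<^sup>2 \<le> (norm (u + t *\<^sub>R d))\<^sup>2" by (simp add: u(2) power_mono)
    also have "\<dots> = (norm u)\<^sup>2 + 2 * t * inner u d + t\<^sup>2 * inner d d"
      unfolding power2_norm_eq_inner by (simp add: algebra_simps inner_commute power2_eq_square)
    also have "\<dots> = (norm u)\<^sup>2 - (inner u d)\<^sup>2 / inner d d"
      using d by (simp add: t_def power2_eq_square field_simps)
    also have "\<dots> < (norm u)\<^sup>2" using ne d by simp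
    finally show False by simp
  qed
  have u0: "inner u u > 0" using u(1) by (auto simp: S_def \<phi>.zero inner_gt_zero_iff)
  show thesis
  proof (rule that[of "u /\<^sub>R inner u u"])
    fix x
    have "inner u (x - \<phi> x *\<^sub>R u) = 0"
      using u(1) by (intro orth) (simp add: S_def \<phi>.diff \<phi>.scaleR)
    then show "\<phi> x = inner (u /\<^sub>R inner u u) x"
      using u0 by (simp add: inner_diff_right field_simps)
  qed
qed

lemma hilbert_adjoint_exists:
  fixes T :: "'a::{real_inner,complete_space} \<Rightarrow> 'b::real_inner"
  assumes "bounded_linear T"
  obtains S where "bounded_linear S" "\<And>x y. inner (T x) y = inner x (S y)"
proof -
  interpret T: bounded_linear T by fact
  have "\<exists>v. \<forall>x. inner (T x) y = inner v x" for y
  proof -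
    have "bounded_linear (\<lambda>x. inner (T x) y)"
      by (intro bounded_linear_inner_left_comp assms)
    then show ?thesis by (metis riesz_representation)
  qed
  then obtain S where S: "\<And>x y. inner (T x) y = inner x (S y)"
    by (metis inner_commute)
  obtain K where K: "K \<ge> 0" "\<And>x. norm (T x) \<le> norm x * K" using T.nonneg_bounded by blast
  have eqI: "v = w" if "\<And>x. inner x v = inner x w" for v w :: 'a
    using that vector_eq_ldot[of v w] by blast
  have "bounded_linear S"
  proof (rule bounded_linear_intro)
    show "S (x + y) = S x + S y" for x y
      by (rule eqI) (simp add: S[symmetric] inner_add_right)
    show "S (r *\<^sub>R x) = r *\<^sub>R S x" for r x
      by (rule eqI) (simp add: S[symmetric])
    show "norm (S y) \<le> norm y * K" for y
    proof (cases "S y = 0")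
      case False
      have "norm (S y) * norm (S y) = inner (T (S y)) y"
        by (simp add: S power2_norm_eq_inner[symmetric] power2_eq_square[symmetric])
      also have "\<dots> \<le> norm (T (S y)) * norm y" by (rule norm_cauchy_schwarz)
      also have "\<dots> \<le> (norm (S y) * K) * norm y" by (intro mult_right_mono K) auto
      finally show ?thesis using False by (simp add: mult_ac)
    qed (use K in simp)
  qed
  with S that show thesis by blast
qed

text \<open>Fixed point iteration for \<open>Y = (B + Y\<^sup>2) / 2\<close>, the equation satisfied
  by the identity minus a square root of the identity minus \<open>B\<close>.\<close>

fun sqrt_approx :: "('a::real_normed_vector \<Rightarrow>\<^sub>L 'a) \<Rightarrow> nat \<Rightarrow> 'a \<Rightarrow>\<^sub>L 'a" where
  "sqrt_approx B 0 = 0"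
| "sqrt_approx B (Suc n) = (1/2) *\<^sub>R (B + (sqrt_approx B n o\<^sub>L sqrt_approx B n))"

text \<open>The same iteration for the scalar 1 in place of \<open>B\<close>; it increases to 1. It
  controls the borderline case \<open>norm B = 1\<close>, in which the operator iteration is not a
  strict contraction.\<close>

fun sqrt_approx_majorant :: "nat \<Rightarrow> real" where
  "sqrt_approx_majorant 0 = 0"
| "sqrt_approx_majorant (Suc n) = (1 + (sqrt_approx_majorant n)\<^sup>2) / 2"

lemma sqrt_approx_majorant_bounds:
  "0 \<le> sqrt_approx_majorant n \<and> sqrt_approx_majorant n \<le> 1"
  by (induction n) (auto simp: power_le_one)

lemma norm_sqrt_approx_le:
  assumes "norm B \<le> 1"
  shows "norm (sqrt_approx B n) \<le> sqrt_approx_majorant n"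
proof (induction n)
  case (Suc n)
  have "norm (B + (sqrt_approx B n o\<^sub>L sqrt_approx B n))
      \<le> 1 + norm (sqrt_approx B n) * norm (sqrt_approx B n)"
    using assms norm_blinfun_compose[of "sqrt_approx B n" "sqrt_approx B n"]
      norm_triangle_ineq[of B "sqrt_approx B n o\<^sub>L sqrt_approx B n"] by linarith
  also have "\<dots> \<le> 1 + sqrt_approx_majorant n * sqrt_approx_majorant n"
    using Suc.IH mult_mono[OF Suc.IH Suc.IH] sqrt_approx_majorant_bounds[of n] by simp
  finally show ?case by (simp add: power2_eq_square)
qed simp

text \<open>A difference of squares splits as \<open>(Z - Y) Z + Y (Z - Y)\<close> without assuming
  that \<open>Y\<close> and \<open>Z\<close> commute, and the scalar iteration splits in the same
  way, so the bound propagates by induction.\<close>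

lemma norm_sqrt_approx_diff_le:
  assumes "norm B \<le> 1"
  shows "norm (sqrt_approx B (Suc n) - sqrt_approx B n)
    \<le> sqrt_approx_majorant (Suc n) - sqrt_approx_majorant n"
proof (induction n)
  case 0
  then show ?case using assms by (simp add: blinfun.bilinear_simps)
next
  case (Suc n)
  let ?Y = "sqrt_approx B n" and ?Z = "sqrt_approx B (Suc n)"
  let ?y = "sqrt_approx_majorant n" and ?z = "sqrt_approx_majorant (Suc n)"
  have "sqrt_approx B (Suc (Suc n)) - ?Z = (1/2) *\<^sub>R ((?Z o\<^sub>L ?Z) - (?Y o\<^sub>L ?Y))"
    by (subst sqrt_approx.simps(2), subst (2) sqrt_approx.simps(2))
      (simp add: algebra_simps del: sqrt_approx.simps)
  also have "(?Z o\<^sub>L ?Z) - (?Y o\<^sub>L ?Y) = ((?Z - ?Y) o\<^sub>L ?Z) + (?Y o\<^sub>L (?Z - ?Y))"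
    by (rule blinfun_eqI) (simp add: blinfun.bilinear_simps del: sqrt_approx.simps)
  also have "norm ((1/2) *\<^sub>R \<dots>) \<le> (norm (?Z - ?Y) * norm ?Z + norm ?Y * norm (?Z - ?Y)) / 2"
    using norm_triangle_ineq[of "(?Z - ?Y) o\<^sub>L ?Z" "?Y o\<^sub>L (?Z - ?Y)"]
      norm_blinfun_compose[of "?Z - ?Y" ?Z] norm_blinfun_compose[of ?Y "?Z - ?Y"]
    by (simp del: sqrt_approx.simps)
  also have "\<dots> \<le> ((?z - ?y) * ?z + ?y * (?z - ?y)) / 2"
  proof -
    have "?y \<le> ?z" using Suc.IH norm_ge_zero[of "?Z - ?Y"] by linarith
    then show ?thesis
      using sqrt_approx_majorant_bounds[of n] sqrt_approx_majorant_bounds[of "Suc n"]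
      by (intro divide_right_mono add_mono mult_mono Suc.IH norm_sqrt_approx_le assms)
        (auto simp del: sqrt_approx.simps sqrt_approx_majorant.simps)
  qed
  also have "\<dots> = sqrt_approx_majorant (Suc (Suc n)) - ?z"
    by (subst (3) sqrt_approx_majorant.simps(2), subst (3) sqrt_approx_majorant.simps(2))
      (simp add: power2_eq_square algebra_simps diff_divide_distrib add_divide_distrib
        del: sqrt_approx_majorant.simps)
  finally show ?case .
qed

text \<open>The increments are dominated by those of the bounded scalar majorant, whose series
  telescopes. Monotonicity of the majorant comes from the same domination, since norms are
  nonnegative.\<close>

lemma sqrt_approx_convergent:
  fixes B :: "'a::banach \<Rightarrow>\<^sub>L 'a"
  assumes "norm B \<le> 1"
  shows "convergent (sqrt_approx B)"
proof -
  let ?y = sqrt_approx_majorant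
  have inc: "incseq ?y"
  proof (rule incseq_SucI)
    fix n show "?y n \<le> ?y (Suc n)"
      using norm_sqrt_approx_diff_le[OF assms, of n] norm_ge_zero[of "sqrt_approx B (Suc n) - sqrt_approx B n"]
      by linarith
  qed
  have "convergent ?y"
    using sqrt_approx_majorant_bounds incseq_convergent[OF inc, of 1]
    unfolding convergent_def by blast
  then have "summable (\<lambda>n. ?y (Suc n) - ?y n)"
    using telescope_summable convergent_def by blast
  then have "summable (\<lambda>n. sqrt_approx B (Suc n) - sqrt_approx B n)"
    using norm_sqrt_approx_diff_le[OF assms] by (rule summable_comparison_test'[where N = 0])
  then have "convergent (\<lambda>n. \<Sum>k<n. sqrt_approx B (Suc k) - sqrt_approx B k)"
    by (simp add: summable_iff_convergent)
  moreover have "(\<Sum>k<n. sqrt_approx B (Suc k) - sqrt_approx B k) = sqrt_approx B n" for n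
    by (subst sum_lessThan_telescope) simp
  ultimately show ?thesis by simp
qed

text \<open>Writing \<open>R = I - Y\<close>, the equation \<open>R\<^sup>2 = I - B\<close> becomes the fixed point
  equation \<open>Y = (B + Y\<^sup>2) / 2\<close>, solved by iteration from \<open>0\<close>.\<close>

lemma sqrt_one_minus_exists:
  fixes B :: "'a::{real_inner,banach} \<Rightarrow> 'a"
  assumes lin: "bounded_linear B" and contr: "\<And>x. norm (B x) \<le> norm x"
    and sa: "\<And>x y. inner (B x) y = inner x (B y)"
  obtains R where "bounded_linear R" "\<And>x y. inner (R x) y = inner x (R y)"
    "\<And>x. 0 \<le> inner (R x) x" "\<And>x. R (R x) = x - B x"
    "\<forall>J. bounded_linear J \<longrightarrow> (\<forall>x. J (B x) = B (J x)) \<longrightarrow> (\<forall>x. J (R x) = R (J x))"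
proof -
  define B' where "B' = Blinfun B"
  have B': "blinfun_apply B' x = B x" for x by (simp add: B'_def lin bounded_linear_Blinfun_apply)
  have nB: "norm B' \<le> 1" using contr by (intro norm_blinfun_bound) (auto simp: B')
  obtain Y where Y: "sqrt_approx B' \<longlonglongrightarrow> Y"
    using sqrt_approx_convergent[OF nB] by (auto simp: convergent_def)
  have Yx: "(\<lambda>n. blinfun_apply (sqrt_approx B' n) x) \<longlonglongrightarrow> blinfun_apply Y x" for x
    by (intro tendsto_intros Y)
  have "(\<lambda>n. sqrt_approx B' (Suc n)) \<longlonglongrightarrow> (1/2) *\<^sub>R (B' + (Y o\<^sub>L Y))"
    unfolding sqrt_approx.simps
    by (intro tendsto_intros bounded_bilinear.tendsto[OF bounded_bilinear_blinfun_compose] Y)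
  then have fp: "Y = (1/2) *\<^sub>R (B' + (Y o\<^sub>L Y))"
    using LIMSEQ_unique[OF LIMSEQ_Suc[OF Y]] by blast
  have "norm Y \<le> 1"
  proof (rule LIMSEQ_le_const2[OF tendsto_norm[OF Y]])
    show "\<exists>N. \<forall>n\<ge>N. norm (sqrt_approx B' n) \<le> 1"
      using norm_sqrt_approx_le[OF nB] sqrt_approx_majorant_bounds order_trans by blast
  qed
  then have nY: "norm (Y x) \<le> norm x" for x
    using norm_blinfun[of Y x] mult_right_mono[of "norm Y" 1 "norm x"] by simp
  have sa_approx: "inner (sqrt_approx B' n x) y = inner x (sqrt_approx B' n y)" for n x y
    by (induction n arbitrary: x y)
      (simp_all add: blinfun.bilinear_simps B' sa inner_add_left inner_add_right)
  have saY: "inner (Y x) y = inner x (Y y)" for x y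
  proof (rule LIMSEQ_unique)
    show "(\<lambda>n. inner (sqrt_approx B' n x) y) \<longlonglongrightarrow> inner (Y x) y"
      by (intro tendsto_intros Yx)
    show "(\<lambda>n. inner (sqrt_approx B' n x) y) \<longlonglongrightarrow> inner x (Y y)"
      unfolding sa_approx by (intro tendsto_intros Yx)
  qed
  \<comment> \<open>Whatever commutes with \<open>B\<close> commutes with every iterate and hence
    with the limit. Taken with \<open>J = cscale c\<close>, this later makes the real-linear root
    complex-linear.\<close>
  have comm: "J (Y x) = Y (J x)" if J: "bounded_linear J" "\<And>x. J (B x) = B (J x)" for J x
  proof -
    interpret J: bounded_linear J by fact
    have "J (sqrt_approx B' n x) = sqrt_approx B' n (J x)" for n x
      by (induction n arbitrary: x)
        (simp_all add: blinfun.bilinear_simps B' J J.zero J.scaleR J.add)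
    then show ?thesis
      using LIMSEQ_unique[OF J.tendsto[OF Yx[of x]]] Yx[of "J x"] by simp
  qed
  show thesis
  proof (rule that[of "\<lambda>x. x - Y x"])
    show "bounded_linear (\<lambda>x. x - blinfun_apply Y x)"
      by (intro bounded_linear_intros)
    show "inner (x - Y x) y = inner x (y - Y y)" for x y
      by (simp add: inner_diff_left inner_diff_right saY)
    show "0 \<le> inner (x - Y x) x" for x
    proof -
      have "inner (Y x) x \<le> norm (Y x) * norm x" by (rule norm_cauchy_schwarz)
      also have "\<dots> \<le> norm x * norm x" by (intro mult_right_mono nY) auto
      finally show ?thesis by (simp add: inner_diff_left power2_norm_eq_inner[symmetric] power2_eq_square)
    qed
    show "(x - Y x) - Y (x - Y x) = x - B x" for x
    proof -
      have "Y x = (1/2) *\<^sub>R (B x + Y (Y x))"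
        using arg_cong[OF fp, of "\<lambda>f. blinfun_apply f x"] by (simp add: blinfun.bilinear_simps B')
      from arg_cong[OF this, of "\<lambda>v. 2 *\<^sub>R v"]
      have "2 *\<^sub>R Y x = B x + Y (Y x)" by (simp only: scaleR_scaleR) simp
      then show ?thesis by (simp add: blinfun.bilinear_simps scaleR_2 algebra_simps)
    qed
    show "\<forall>J. bounded_linear J \<longrightarrow> (\<forall>x. J (B x) = B (J x)) \<longrightarrow> (\<forall>x. J (x - Y x) = J x - Y (J x))"
      by (simp add: comm linear_diff[OF bounded_linear.linear])
  qed
qed

text \<open>Substitute for weak sequential compactness. If \<open>inner (X n) v\<close> converges, a
  tail of the sequence lies in a thin slab between two half-spaces; the slab is closed and convex,
  so it contains the closed hull of that tail and with it \<open>h\<close>. Membership in the closed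
  hull of the range keeps \<open>h\<close> in any closed subspace that contains the
  sequence.\<close>

lemma bounded_seq_convex_cluster:
  fixes X :: "nat \<Rightarrow> 'a::{real_inner,complete_space}"
  assumes "\<And>n. norm (X n) \<le> B"
  obtains h where "h \<in> closure (convex hull (range X))"
    "\<And>v c. (\<lambda>n. inner (X n) v) \<longlonglongrightarrow> c \<Longrightarrow> inner h v = c"
proof -
  define C where "C m = closure (convex hull (X ` {m..}))" for m
  have "\<exists>h. \<forall>m. h \<in> C m"
  proof (rule decreasing_closed_convex_inter_nonempty)
    show "C n \<subseteq> C m" if "m \<le> n" for m n
      unfolding C_def using that by (intro closure_mono hull_mono image_mono) auto
    have "X m \<in> C m" for m
      unfolding C_def by (rule subsetD[OF closure_subset]) (auto intro: hull_inc)
    then show "\<exists>x\<in>C m. norm x \<le> B" for m using assms by blast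
  qed (auto simp: C_def convex_closure)
  then obtain h where h: "\<And>m. h \<in> C m" by blast
  show thesis
  proof (rule that)
    have "X ` {0..} = range X" by auto
    then show "h \<in> closure (convex hull (range X))" using h[of 0] by (simp add: C_def)
    fix v c assume lim: "(\<lambda>n. inner (X n) v) \<longlonglongrightarrow> c"
    have "\<bar>inner h v - c\<bar> \<le> e" if e: "e > 0" for e
    proof -
      obtain m where m: "\<And>n. n \<ge> m \<Longrightarrow> \<bar>inner (X n) v - c\<bar> < e"
        using LIMSEQ_D[OF lim e] by auto
      let ?S = "{x. inner v x \<ge> c - e} \<inter> {x. inner v x \<le> c + e}"
      have "C m \<subseteq> ?S"
        unfolding C_def
      proof (intro closure_minimal hull_minimal)
        show "X ` {m..} \<subseteq> ?S" using m by (fastforce simp: inner_commute[of v] abs_less_iff)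
        show "closed ?S" by (intro closed_Int closed_halfspace_ge closed_halfspace_le)
        show "convex ?S" by (intro convex_Int convex_halfspace_ge convex_halfspace_le)
      qed
      then show ?thesis using h[of m] by (force simp: inner_commute[of v] abs_le_iff)
    qed
    then show "inner h v = c"
      using field_le_epsilon[of "\<bar>inner h v - c\<bar>" 0] by simp
  qed
qed

text \<open>The eventual bound on \<open>G\<close> makes the pairings uniformly continuous in
  \<open>v\<close>. Hence weak convergence needs to be tested only on a set with dense span.\<close>

lemma closed_weak_limit_set:
  fixes G :: "'b \<Rightarrow> 'a::real_inner"
  assumes bd: "\<forall>\<^sub>F z in F. norm (G z) \<le> B"
  shows "closed {v. ((\<lambda>z. inner (G z) v) \<longlongrightarrow> inner h v) F}"
  unfolding closed_limpt islimpt_approachable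
proof (intro allI impI, unfold mem_Collect_eq)
  fix v
  assume app: "\<forall>e>0. \<exists>v'\<in>{v. ((\<lambda>z. inner (G z) v) \<longlongrightarrow> inner h v) F}. v' \<noteq> v \<and> dist v' v < e"
  show "((\<lambda>z. inner (G z) v) \<longlongrightarrow> inner h v) F"
  proof (rule tendstoI)
    fix e :: real assume e: "e > 0"
    define K where "K = \<bar>B\<bar> + norm h + 1"
    have K: "K > 0" by (simp add: K_def add_nonneg_pos)
    obtain v' where v': "((\<lambda>z. inner (G z) v') \<longlongrightarrow> inner h v') F" "dist v' v < e / (2 * K)"
      using app e K by (metis (no_types, lifting) divide_pos_pos mem_Collect_eq mult_pos_pos zero_less_numeral)
    have "\<forall>\<^sub>F z in F. dist (inner (G z) v') (inner h v') < e / 2"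
      using e by (intro tendstoD[OF v'(1)]) simp
    with bd show "\<forall>\<^sub>F z in F. dist (inner (G z) v) (inner h v) < e"
    proof eventually_elim
      fix z assume z: "norm (G z) \<le> B" "dist (inner (G z) v') (inner h v') < e / 2"
      have "inner (G z) v - inner h v = (inner (G z) v' - inner h v') + inner (G z - h) (v - v')"
        by (simp add: inner_diff_left inner_diff_right)
      moreover have "\<bar>inner (G z - h) (v - v')\<bar> \<le> norm (G z - h) * norm (v - v')"
        by (rule Cauchy_Schwarz_ineq2)
      moreover have "norm (G z - h) * norm (v - v') \<le> K * (e / (2 * K))"
        using z(1) v'(2) norm_triangle_ineq4[of "G z" h] K
        by (intro mult_mono) (auto simp: K_def dist_norm norm_minus_commute)
      ultimately show "dist (inner (G z) v) (inner h v) < e"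
        using z(2) K abs_triangle_ineq[of "inner (G z) v' - inner h v'" "inner (G z - h) (v - v')"]
        by (simp add: dist_real_def)
    qed
  qed
qed

section \<open>The Hardy space as a sequence space\<close>

lemma power2_norm_vec: "(norm x)\<^sup>2 = (\<Sum>i\<in>UNIV. (norm (x $ i))\<^sup>2)"
  for x :: "'a::real_normed_vector ^ 'n"
  by (simp add: norm_vec_def L2_set_def sum_nonneg)

lemma norm_vector_smult: "norm (c *s x) = cmod c * norm x" for x :: "complex ^ 'n"
proof -
  have "(norm (c *s x))\<^sup>2 = (cmod c * norm x)\<^sup>2"
    by (simp add: power2_norm_vec power_mult_distrib norm_mult sum_distrib_left)
  then show ?thesis by (rule power2_eq_imp_eq) auto
qed

lemma inner_eq_Re_cinner: "inner x y = Re (cinner x y)" for x y :: "complex ^ 'n"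
  by (simp add: inner_vec_def cinner_def inner_complex_def)

lemma cinner_diff_left: "cinner (x - y) z = cinner x z - cinner y z"
  by (simp add: cinner_def left_diff_distrib sum_subtractf)

lemma cinner_smult_left: "cinner (c *s x) y = c * cinner x y"
  by (simp add: cinner_def sum_distrib_left mult.assoc)

lemma cinner_smult_right: "cinner x (c *s y) = cnj c * cinner x y"
  by (simp add: cinner_def sum_distrib_left mult_ac)

lemma cinner_eq_Complex: "cinner x y = Complex (inner x y) (inner x (\<i> *s y))"
  by (simp add: inner_eq_Re_cinner cinner_smult_right complex_eq_iff)

lemma cinner_mat_left: "cinner (A *v x) y = cinner x (mat_adj A *v y)"
proof -
  have "cinner (A *v x) y = (\<Sum>i\<in>UNIV. \<Sum>j\<in>UNIV. A $ i $ j * x $ j * cnj (y $ i))"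
    by (simp add: cinner_def matrix_vector_mult_def sum_distrib_right)
  also have "\<dots> = (\<Sum>j\<in>UNIV. \<Sum>i\<in>UNIV. A $ i $ j * x $ j * cnj (y $ i))"
    by (rule sum.swap)
  also have "\<dots> = cinner x (mat_adj A *v y)"
    by (simp add: cinner_def matrix_vector_mult_def mat_adj_def sum_distrib_left mult_ac)
  finally show ?thesis .
qed

lemma inner_mat_left: "inner (A *v x) y = inner x (mat_adj A *v y)" for A :: "complex ^ 'n ^ 'm"
  by (simp add: inner_eq_Re_cinner cinner_mat_left)

lemma inner_smult_left: "inner (c *s x) y = inner x (cnj c *s y)" for x :: "complex ^ 'n"
  by (simp add: inner_eq_Re_cinner cinner_smult_left cinner_smult_right)

lemma summable_norm2_smult:
  fixes a :: "nat \<Rightarrow> complex ^ 'n"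
  assumes "summable (\<lambda>k. (norm (a k))\<^sup>2)"
  shows "summable (\<lambda>k. (norm (c *s a k))\<^sup>2)"
  using summable_mult[OF assms, of "(cmod c)\<^sup>2"] by (simp add: norm_vector_smult power_mult_distrib)

text \<open>The complex structure on the real space \<open>ell2\<close>. With it the complex inner
  product of \<open>a\<close> and \<open>d\<close> is
  \<open>Complex (inner a d) (inner a (cscale \<i> d))\<close>.\<close>

lift_definition cscale :: "complex \<Rightarrow> (complex ^ 'n) ell2 \<Rightarrow> (complex ^ 'n) ell2"
  is "\<lambda>c a k. c *s a k"
  by (simp add: summable_norm2_smult)

lemma norm_cscale: "norm (cscale c a) = cmod c * norm a"
proof -
  have "(norm (cscale c a))\<^sup>2 = (cmod c * norm a)\<^sup>2"
    unfolding power_mult_distrib norm_ell2_sq cscale.rep_eq norm_vector_smult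
    by (rule suminf_mult) (rule summable_Rep_ell2)
  then show ?thesis by (rule power2_eq_imp_eq) auto
qed

lemma cscale_add_right: "cscale c (a + b) = cscale c a + cscale c b"
  by transfer (simp add: fun_eq_iff vec_eq_iff algebra_simps)

lemma cscale_cscale: "cscale c (cscale d a) = cscale (c * d) a"
  by transfer (simp add: fun_eq_iff vec_eq_iff)

lemma cscale_of_real: "cscale (of_real r) a = r *\<^sub>R a"
  by transfer (simp add: fun_eq_iff vec_eq_iff scaleR_conv_of_real[where 'a = complex])

lemma bounded_linear_cscale: "bounded_linear (cscale c)"
proof (rule bounded_linear_intro[where K = "cmod c"])
  show "cscale c (r *\<^sub>R a) = r *\<^sub>R cscale c a" for r a
    by (simp flip: cscale_of_real add: cscale_cscale mult.commute)
qed (auto simp: cscale_add_right norm_cscale mult.commute)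

lemma inner_cscale_left: "inner (cscale c a) b = inner a (cscale (cnj c) b)"
  unfolding inner_ell2.rep_eq cscale.rep_eq inner_smult_left ..

text \<open>\<open>fun_of\<close> and \<open>ell2_of\<close> identify \<open>ell2\<close> with
  \<open>H2\<close> up to values outside the disc. \<open>fun_of\<close> picks one representative
  for each sequence, while \<open>ell2_of\<close> is meaningful on \<open>H2\<close> only.\<close>

definition fun_of :: "(complex ^ 'n) ell2 \<Rightarrow> complex \<Rightarrow> complex ^ 'n" where
  "fun_of a z = (\<chi> i. \<Sum>k. Rep_ell2 a k $ i * z ^ k)"

definition ell2_of :: "(complex \<Rightarrow> complex ^ 'n) \<Rightarrow> (complex ^ 'n) ell2" where
  "ell2_of f = Abs_ell2 (taylor_coeff f)"

lemma fun_of_sums: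
  assumes "z \<in> ball 0 1"
  shows "(\<lambda>k. Rep_ell2 a k $ i * z ^ k) sums (fun_of a z $ i)"
proof -
  have "summable (\<lambda>k. Rep_ell2 a k $ i * z ^ k)"
  proof (rule summable_comparison_test')
    show "summable (\<lambda>k. norm a * norm z ^ k)"
      using assms by (intro summable_mult summable_geometric) simp
    have "norm (Rep_ell2 a k $ i) \<le> norm a" for k
      using Finite_Cartesian_Product.norm_nth_le[of "Rep_ell2 a k" i] norm_Rep_ell2_le[of a k] by linarith
    then show "norm (Rep_ell2 a k $ i * z ^ k) \<le> norm a * norm z ^ k" for k
      by (simp add: norm_mult norm_power mult_right_mono)
  qed
  then show ?thesis by (simp add: fun_of_def summable_sums)
qed

lemma fun_of_holomorphic: "(\<lambda>z. fun_of a z $ i) holomorphic_on ball 0 1"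
  by (rule power_series_holomorphic[where a = "\<lambda>k. Rep_ell2 a k $ i"])
    (use fun_of_sums in \<open>auto simp del: mem_ball\<close>)

lemma taylor_coeff_fun_of: "taylor_coeff (fun_of a) = Rep_ell2 a"
proof -
  have "Rep_ell2 a k $ i = (deriv ^^ k) (\<lambda>z. fun_of a z $ i) 0 / fact k" for k i
  proof -
    have "\<forall>\<^sub>F z in nhds 0. z \<in> ball 0 (1::real)"
      by (intro eventually_nhds_in_open) auto
    then have "(\<lambda>z. fun_of a z $ i) has_fps_expansion Abs_fps (\<lambda>k. Rep_ell2 a k $ i)"
      by (intro has_fps_expansionI eventually_mono[OF eventually_nhds_in_open[of "ball 0 1"]])
        (auto intro!: fun_of_sums)
    from fps_nth_fps_expansion[OF this, of k] show ?thesis by simp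
  qed
  then show ?thesis by (simp add: taylor_coeff_def fun_eq_iff vec_eq_iff)
qed

lemma fun_of_in_H2: "fun_of a \<in> H2"
  by (simp add: H2_def fun_of_holomorphic taylor_coeff_fun_of summable_Rep_ell2)

lemma ell2_of_fun_of: "ell2_of (fun_of a) = a"
  by (simp add: ell2_of_def taylor_coeff_fun_of Rep_ell2_inverse)

lemma Rep_ell2_ell2_of: "f \<in> H2 \<Longrightarrow> Rep_ell2 (ell2_of f) = taylor_coeff f"
  by (simp add: ell2_of_def H2_def Abs_ell2_inverse)

lemma taylor_sums:
  fixes f :: "complex \<Rightarrow> complex ^ 'n"
  assumes "(\<lambda>z. f z $ i) holomorphic_on ball 0 1" "z \<in> ball 0 1"
  shows "(\<lambda>k. taylor_coeff f k $ i * z ^ k) sums (f z $ i)"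
  using holomorphic_power_series[OF assms] by (simp add: taylor_coeff_def)

lemma fun_of_ell2_of:
  assumes "f \<in> H2" "z \<in> ball 0 1"
  shows "fun_of (ell2_of f) z = f z"
proof -
  have "fun_of (ell2_of f) z $ i = f z $ i" for i
    using fun_of_sums[OF assms(2), of "ell2_of f" i] taylor_sums[of f i z] assms
    by (intro sums_unique2[where f = "\<lambda>k. taylor_coeff f k $ i * z ^ k"])
      (auto simp: Rep_ell2_ell2_of H2_def)
  then show ?thesis by (simp add: vec_eq_iff)
qed

lemma taylor_coeff_cong:
  assumes "eq_on_disc f g"
  shows "taylor_coeff f = taylor_coeff g"
proof -
  have "(deriv ^^ k) (\<lambda>z. f z $ i) 0 = (deriv ^^ k) (\<lambda>z. g z $ i) 0" for k i
    using assms by (intro higher_deriv_cong_ev eventually_mono[OF eventually_nhds_in_open[of "ball 0 1"]])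
      (auto simp: eq_on_disc_def)
  then show ?thesis by (simp add: taylor_coeff_def fun_eq_iff)
qed

lemma ell2_of_cong: "eq_on_disc f g \<Longrightarrow> ell2_of f = ell2_of g"
  by (simp add: ell2_of_def taylor_coeff_cong)

lemma H2_cong:
  assumes "f \<in> H2" "eq_on_disc f g"
  shows "g \<in> H2"
proof -
  have "(\<lambda>z. g z $ i) holomorphic_on ball 0 1 \<longleftrightarrow> (\<lambda>z. f z $ i) holomorphic_on ball 0 1" for i
    using assms(2) by (intro holomorphic_cong) (auto simp: eq_on_disc_def)
  with assms show ?thesis by (simp add: H2_def taylor_coeff_cong[OF assms(2)])
qed

lemma H2_norm_eq: "f \<in> H2 \<Longrightarrow> H2_norm f = norm (ell2_of f)"
  by (simp add: H2_norm_def Rep_ell2_ell2_of[symmetric] norm_ell2_sq[symmetric])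

lemma H2_inner_eq:
  assumes "f \<in> H2" "g \<in> H2"
  shows "H2_inner f g = Complex (inner (ell2_of f) (ell2_of g)) (inner (ell2_of f) (cscale \<i> (ell2_of g)))"
proof -
  have s1: "(\<lambda>k. inner (Rep_ell2 (ell2_of f) k) (Rep_ell2 b k)) sums inner (ell2_of f) b" for b
    unfolding inner_ell2.rep_eq by (intro summable_sums summable_inner summable_Rep_ell2)
  have "(\<lambda>k. cinner (taylor_coeff f k) (taylor_coeff g k)) sums
      Complex (inner (ell2_of f) (ell2_of g)) (inner (ell2_of f) (cscale \<i> (ell2_of g)))"
    using s1[of "ell2_of g"] s1[of "cscale \<i> (ell2_of g)"]
    by (simp add: sums_complex_iff cinner_eq_Complex Rep_ell2_ell2_of assms cscale.rep_eq)
  then show ?thesis by (simp add: H2_inner_def sums_iff)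
qed

lemma fun_of_cscale_add:
  assumes "z \<in> ball 0 1"
  shows "fun_of (cscale c a + b) z = c *s fun_of a z + fun_of b z"
proof -
  have "fun_of (cscale c a + b) z $ i = c * fun_of a z $ i + fun_of b z $ i" for i
  proof (rule sums_unique2[OF fun_of_sums[OF assms]])
    show "(\<lambda>k. Rep_ell2 (cscale c a + b) k $ i * z ^ k) sums (c * fun_of a z $ i + fun_of b z $ i)"
      using sums_add[OF sums_mult[OF fun_of_sums[OF assms, of a i], of c] fun_of_sums[OF assms, of b i]]
      by (simp add: plus_ell2.rep_eq cscale.rep_eq algebra_simps)
  qed
  then show ?thesis by (simp add: vec_eq_iff)
qed

lemma fun_of_zero [simp]: "fun_of 0 z = 0"
  by (simp add: fun_of_def zero_ell2.rep_eq vec_eq_iff)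

lemma fun_of_cscale: "z \<in> ball 0 1 \<Longrightarrow> fun_of (cscale c a) z = c *s fun_of a z"
  using fun_of_cscale_add[of z c a 0] by simp

lemma ell2_of_lin:
  assumes "f \<in> H2" "g \<in> H2"
  shows "(\<lambda>z. c *s f z + g z) \<in> H2" "ell2_of (\<lambda>z. c *s f z + g z) = cscale c (ell2_of f) + ell2_of g"
proof -
  have eq: "eq_on_disc (fun_of (cscale c (ell2_of f) + ell2_of g)) (\<lambda>z. c *s f z + g z)"
    by (simp add: eq_on_disc_def fun_of_cscale_add fun_of_ell2_of assms del: mem_ball)
  show "(\<lambda>z. c *s f z + g z) \<in> H2" by (rule H2_cong[OF fun_of_in_H2 eq])
  show "ell2_of (\<lambda>z. c *s f z + g z) = cscale c (ell2_of f) + ell2_of g"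
    using ell2_of_cong[OF eq] by (simp add: ell2_of_fun_of)
qed

section \<open>Szego kernels\<close>

lemma summable_norm2_geometric:
  fixes e :: "complex ^ 'n"
  shows "summable (\<lambda>k. (norm (if cmod w < 1 then cnj w ^ k *s e else 0))\<^sup>2)"
proof (cases "cmod w < 1")
  case True
  then have "(cmod w)\<^sup>2 < 1" by (simp add: power_less_one_iff)
  then have "summable (\<lambda>k. ((cmod w)\<^sup>2) ^ k * (norm e)\<^sup>2)"
    by (intro summable_mult2 summable_geometric) simp
  then show ?thesis using True
    by (simp add: norm_vector_smult norm_power power_mult_distrib power_mult[symmetric] mult.commute)
qed simp

text \<open>The Taylor coefficients of \<open>e / (1 - z * cnj w)\<close>; the value 0 for
  \<open>w\<close> outside the disc makes the map total.\<close>

lift_definition szego :: "complex \<Rightarrow> complex ^ 'n \<Rightarrow> (complex ^ 'n) ell2"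
  is "\<lambda>w e k. if cmod w < 1 then cnj w ^ k *s e else 0"
  by (simp only: mem_Collect_eq summable_norm2_geometric)

lemma inner_szego:
  assumes "w \<in> ball 0 1"
  shows "inner a (szego w e) = inner (fun_of a w) e"
proof -
  have "(\<lambda>k. \<Sum>i\<in>UNIV. Rep_ell2 a k $ i * w ^ k * cnj (e $ i)) sums cinner (fun_of a w) e"
    unfolding cinner_def by (intro sums_sum sums_mult2 fun_of_sums assms)
  also have "(\<lambda>k. \<Sum>i\<in>UNIV. Rep_ell2 a k $ i * w ^ k * cnj (e $ i)) = (\<lambda>k. cinner (Rep_ell2 a k) (cnj w ^ k *s e))"
    by (simp add: cinner_def mult_ac fun_eq_iff)
  finally have "(\<lambda>k. Re (cinner (Rep_ell2 a k) (cnj w ^ k *s e))) sums Re (cinner (fun_of a w) e)"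
    by (rule sums_Re)
  then have "(\<lambda>k. inner (Rep_ell2 a k) (Rep_ell2 (szego w e) k)) sums inner (fun_of a w) e"
    using assms by (simp add: inner_eq_Re_cinner szego.rep_eq)
  then show ?thesis by (simp add: inner_ell2.rep_eq sums_iff)
qed

lemma fun_of_szego:
  assumes "w \<in> ball 0 1" "z \<in> ball 0 1"
  shows "fun_of (szego w e) z = inverse (1 - z * cnj w) *s e"
proof -
  have "fun_of (szego w e) z $ i = inverse (1 - z * cnj w) * e $ i" for i
  proof (rule sums_unique2[OF fun_of_sums[OF assms(2)]])
    have "cmod (z * cnj w) < 1"
      using assms mult_strict_mono'[of "cmod z" 1 "cmod w" 1] by (simp add: norm_mult)
    from sums_mult2[OF geometric_sums[OF this], of "e $ i"]
    show "(\<lambda>k. Rep_ell2 (szego w e) k $ i * z ^ k) sums (inverse (1 - z * cnj w) * e $ i)"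
      using assms by (simp add: szego.rep_eq power_mult_distrib mult_ac inverse_eq_divide)
  qed
  then show ?thesis by (simp add: vec_eq_iff)
qed

lemma cscale_szego: "cscale c (szego w e) = szego w (c *s e)"
  by transfer (auto simp: fun_eq_iff vec_eq_iff)

lemma szego_add: "szego w (x + y) = szego w x + szego w y"
  by transfer (auto simp: fun_eq_iff vec_eq_iff algebra_simps)

section \<open>Mean values on circles\<close>

lemma has_integral_cis_orthogonal:
  "((\<lambda>t. cis t ^ k * cnj (cis t ^ l)) has_integral (if k = l then of_real (2 * pi) else 0)) {0..2 * pi}"
proof -
  define m where "m = real k - real l"
  have eq: "cis t ^ k * cnj (cis t ^ l) = cis (m * t)" for t
  proof -
    have "real k * t + - (real l * t) = m * t" by (simp add: m_def algebra_simps)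
    then show ?thesis by (simp only: Complex.DeMoivre cis_cnj cis_mult)
  qed
  show ?thesis
  proof (cases "k = l")
    case True
    have "((\<lambda>t::real. 1 :: complex) has_integral (2 * pi - 0) *\<^sub>R 1) {0..2 * pi}"
      using has_integral_const_real[of "1::complex" 0 "2 * pi"] by simp
    then show ?thesis unfolding eq using True by (simp add: m_def scaleR_conv_of_real)
  next
    case False
    then have m: "m \<noteq> 0" by (simp add: m_def)
    have "((\<lambda>t. cis (m * t)) has_integral
        cis (m * (2 * pi)) / (\<i> * of_real m) - cis (m * 0) / (\<i> * of_real m)) {0..2 * pi}"
    proof (rule fundamental_theorem_of_calculus)
      fix t :: real
      have "((\<lambda>w. exp (\<i> * of_real m * w) / (\<i> * of_real m)) has_field_derivative
          exp (\<i> * of_real m * of_real t)) (at (of_real t))"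
        using m by (auto intro!: derivative_eq_intros)
      from has_vector_derivative_real_field[OF this]
      show "((\<lambda>t. cis (m * t) / (\<i> * of_real m)) has_vector_derivative cis (m * t)) (at t within {0..2 * pi})"
        by (simp add: cis_conv_exp mult.assoc)
    qed simp
    moreover have "cis (m * (2 * pi)) = 1"
      using cis_multiple_2pi[of m] by (simp add: m_def mult.commute)
    ultimately show ?thesis unfolding eq using False by simp
  qed
qed

text \<open>Parseval's identity on a circle strictly inside the disc: for Taylor polynomials it is
  orthogonality of the powers of \<open>cis t\<close>, and uniform convergence carries the integrals
  to the limit. It links pointwise bounds to Taylor coefficients.\<close>

lemma circle_mean_square:
  fixes f :: "complex \<Rightarrow> complex"
  assumes hol: "f holomorphic_on ball 0 1" and r: "0 < r" "r < 1"
  defines "a \<equiv> \<lambda>k. (deriv ^^ k) f 0 / fact k"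
  obtains J where "((\<lambda>t. (cmod (f (of_real r * cis t)))\<^sup>2) has_integral 2 * pi * J) {0..2 * pi}"
    "(\<lambda>k. (cmod (a k))\<^sup>2 * r ^ (2 * k)) sums J"
proof -
  define z where "z t = of_real r * cis t" for t
  define p where "p N t = (\<Sum>k<N. a k * z t ^ k)" for N t
  have z_in: "z t \<in> cball 0 r" "z t \<in> ball 0 1" for t using r by (auto simp: z_def norm_mult)
  have fz: "(\<lambda>k. a k * w ^ k) sums f w" if "w \<in> ball 0 1" for w
    using holomorphic_power_series[OF hol that] by (simp add: a_def)
  have unif_cball: "uniform_limit (cball 0 r) (\<lambda>N w. \<Sum>k<N. a k * w ^ k) f sequentially"
  proof -
    \<comment> \<open>Uniform convergence on \<open>cball 0 r\<close> needs a radius of convergence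
      strictly larger than \<open>r\<close>; convergence of the series at \<open>s\<close> supplies
      it.\<close>
    obtain s where s: "r < s" "s < 1" using r dense by blast
    have "summable (\<lambda>k. a k * of_real s ^ k)"
      using fz[of "of_real s"] s r by (auto simp: sums_iff)
    from conv_radius_geI[OF this] have "ereal s \<le> conv_radius a" using s r by simp
    with s(1) have "ereal r < conv_radius a" by (metis ereal_less_eq(3) less_le_trans less_ereal.simps(1))
    from powser_uniform_limit[OF this, of 0]
    have "uniform_limit (cball 0 r) (\<lambda>N w. \<Sum>k<N. a k * w ^ k) (\<lambda>w. \<Sum>k. a k * w ^ k) sequentially"
      by simp
    moreover have "(\<Sum>k. a k * w ^ k) = f w" if "w \<in> cball 0 r" for w
      using fz[of w] that r by (simp add: sums_iff)
    ultimately show ?thesis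
      using uniform_limit_cong'[of "cball 0 r" "\<lambda>N w. \<Sum>k<N. a k * w ^ k" "\<lambda>N w. \<Sum>k<N. a k * w ^ k"
          "\<lambda>w. \<Sum>k. a k * w ^ k" f] by blast
  qed
  have unif: "uniform_limit {0..2 * pi} p (\<lambda>t. f (z t)) sequentially"
    unfolding p_def by (rule uniform_limit_compose'[OF unif_cball]) (use z_in in auto)
  have contz: "continuous_on {0..2 * pi} z"
    unfolding z_def by (intro continuous_intros)
  have "continuous_on {0..2 * pi} (\<lambda>t. f (z t))"
    by (rule continuous_on_compose2[OF holomorphic_on_imp_continuous_on[OF hol] contz])
      (use z_in in auto)
  then have "compact ((\<lambda>t. f (z t)) ` {0..2 * pi})"
    by (rule compact_continuous_image) simp
  then have bdd: "bounded ((\<lambda>t. f (z t)) ` {0..2 * pi})" by (rule compact_imp_bounded)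
  have unif2: "uniform_limit {0..2 * pi} (\<lambda>N t. p N t * cnj (p N t)) (\<lambda>t. f (z t) * cnj (f (z t))) sequentially"
  proof (rule uniform_lim_mult[OF unif bounded_linear.uniform_limit[OF bounded_linear_cnj unif] bdd])
    show "bounded ((\<lambda>t. cnj (f (z t))) ` {0..2 * pi})"
      using bdd by (auto simp: bounded_iff)
  qed
  define S where "S N = (\<Sum>k<N. (cmod (a k))\<^sup>2 * r ^ (2 * k))" for N
  have int_p: "((\<lambda>t. p N t * cnj (p N t)) has_integral of_real (2 * pi * S N)) {0..2 * pi}" for N
  proof -
    have "((\<lambda>t. \<Sum>k<N. \<Sum>l<N. a k * cnj (a l) * of_real (r ^ (k + l)) * (cis t ^ k * cnj (cis t ^ l)))
        has_integral (\<Sum>k<N. \<Sum>l<N. a k * cnj (a l) * of_real (r ^ (k + l)) * (if k = l then of_real (2 * pi) else 0)))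
        {0..2 * pi}"
      by (intro has_integral_sum has_integral_mult_right has_integral_cis_orthogonal) auto
    moreover have "(\<Sum>k<N. \<Sum>l<N. a k * cnj (a l) * of_real (r ^ (k + l)) * (cis t ^ k * cnj (cis t ^ l)))
        = p N t * cnj (p N t)" for t
      by (simp add: p_def z_def sum_product power_mult_distrib power_add mult_ac)
    moreover have "(\<Sum>k<N. \<Sum>l<N. a k * cnj (a l) * of_real (r ^ (k + l)) * (if k = l then of_real (2 * pi) else 0))
        = (\<Sum>k<N. of_real (2 * pi) * of_real ((cmod (a k))\<^sup>2 * r ^ (2 * k)))"
    proof (rule sum.cong[OF refl])
      fix k assume "k \<in> {..<N}"
      then have "(\<Sum>l<N. a k * cnj (a l) * of_real (r ^ (k + l)) * (if k = l then of_real (2 * pi) else 0))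
          = a k * cnj (a k) * of_real (r ^ (k + k)) * of_real (2 * pi)"
        by (subst sum.remove[of _ k]) (auto intro!: sum.neutral)
      then show "(\<Sum>l<N. a k * cnj (a l) * of_real (r ^ (k + l)) * (if k = l then of_real (2 * pi) else 0))
          = of_real (2 * pi) * of_real ((cmod (a k))\<^sup>2 * r ^ (2 * k))"
        by (simp only: complex_norm_square[symmetric] of_real_mult mult_2[of k]) (simp add: mult_ac)
    qed
    ultimately show ?thesis by (simp add: S_def sum_distrib_left)
  qed
  have contp: "continuous_on {0..2 * pi} (\<lambda>t. p N t * cnj (p N t))" for N
    unfolding p_def by (intro continuous_intros contz)
  obtain I J where I: "\<And>N. ((\<lambda>t. p N t * cnj (p N t)) has_integral I N) {0..2 * pi}"
    and J: "((\<lambda>t. f (z t) * cnj (f (z t))) has_integral J) {0..2 * pi}" and IJ: "I \<longlonglongrightarrow> J"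
    using uniform_limit_integral[OF unif2 contp] by auto
  have "I = (\<lambda>N. of_real (2 * pi * S N))"
    using has_integral_unique[OF I int_p] by auto
  then have "(\<lambda>N. Re (of_real (2 * pi * S N)) / (2 * pi)) \<longlonglongrightarrow> Re J / (2 * pi)"
    using IJ by (intro tendsto_intros) auto
  then have "(\<lambda>k. (cmod (a k))\<^sup>2 * r ^ (2 * k)) sums (Re J / (2 * pi))"
    by (simp add: sums_def S_def)
  moreover have "((\<lambda>t. (cmod (f (z t)))\<^sup>2) has_integral Re J) {0..2 * pi}"
    using has_integral_linear[OF J bounded_linear_Re] by (simp add: o_def complex_mult_cnj cmod_power2)
  ultimately show thesis by (intro that[of "Re J / (2 * pi)"]) (simp_all add: z_def)
qed

lemma circle_mean_square_vec:
  fixes f :: "complex \<Rightarrow> complex ^ 'n"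
  assumes hol: "\<And>i. (\<lambda>z. f z $ i) holomorphic_on ball 0 1" and r: "0 < r" "r < 1"
  obtains J where "((\<lambda>t. (norm (f (of_real r * cis t)))\<^sup>2) has_integral 2 * pi * J) {0..2 * pi}"
    "(\<lambda>k. (norm (taylor_coeff f k))\<^sup>2 * r ^ (2 * k)) sums J"
proof -
  have "\<forall>i. \<exists>J. ((\<lambda>t. (cmod (f (of_real r * cis t) $ i))\<^sup>2) has_integral 2 * pi * J) {0..2 * pi} \<and>
      (\<lambda>k. (cmod (taylor_coeff f k $ i))\<^sup>2 * r ^ (2 * k)) sums J"
  proof
    fix i
    show "\<exists>J. ((\<lambda>t. (cmod (f (of_real r * cis t) $ i))\<^sup>2) has_integral 2 * pi * J) {0..2 * pi} \<and>
        (\<lambda>k. (cmod (taylor_coeff f k $ i))\<^sup>2 * r ^ (2 * k)) sums J"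
      using circle_mean_square[OF hol r, of i] by (auto simp: taylor_coeff_def)
  qed
  from choice[OF this]
  obtain J where J: "\<And>i. ((\<lambda>t. (cmod (f (of_real r * cis t) $ i))\<^sup>2) has_integral 2 * pi * J i) {0..2 * pi}"
    "\<And>i. (\<lambda>k. (cmod (taylor_coeff f k $ i))\<^sup>2 * r ^ (2 * k)) sums J i"
    by blast
  show thesis
  proof (rule that[of "\<Sum>i\<in>UNIV. J i"])
    show "((\<lambda>t. (norm (f (of_real r * cis t)))\<^sup>2) has_integral 2 * pi * (\<Sum>i\<in>UNIV. J i)) {0..2 * pi}"
      unfolding power2_norm_vec sum_distrib_left by (intro has_integral_sum J) auto
    show "(\<lambda>k. (norm (taylor_coeff f k))\<^sup>2 * r ^ (2 * k)) sums (\<Sum>i\<in>UNIV. J i)"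
      unfolding power2_norm_vec sum_distrib_right by (intro sums_sum J)
  qed
qed

text \<open>A pointwise bound passes to mean squares over circles of radius \<open>r < 1\<close>,
  which are the coefficient sums weighted by \<open>r ^ (2 * k)\<close>. This is why multiplication
  by a Schur function is a contraction of \<open>H2\<close>.\<close>

lemma H2_dominated:
  fixes f g :: "complex \<Rightarrow> complex ^ 'n"
  assumes f: "f \<in> H2" and g: "\<And>i. (\<lambda>z. g z $ i) holomorphic_on ball 0 1"
    and le: "\<And>z. z \<in> ball 0 1 \<Longrightarrow> norm (g z) \<le> norm (f z)"
  shows "g \<in> H2" "norm (ell2_of g) \<le> norm (ell2_of f)"
proof -
  let ?F = "(norm (ell2_of f))\<^sup>2"
  have holf: "(\<lambda>z. f z $ i) holomorphic_on ball 0 1" for i using f by (simp add: H2_def)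
  have r_bound: "(\<Sum>k<N. (norm (taylor_coeff g k))\<^sup>2 * r ^ (2 * k)) \<le> ?F" if r: "0 < r" "r < 1" for N and r :: real
  proof -
    obtain J where J: "((\<lambda>t. (norm (f (of_real r * cis t)))\<^sup>2) has_integral 2 * pi * J) {0..2 * pi}"
      "(\<lambda>k. (norm (taylor_coeff f k))\<^sup>2 * r ^ (2 * k)) sums J"
      using circle_mean_square_vec[OF holf r] .
    obtain K where K: "((\<lambda>t. (norm (g (of_real r * cis t)))\<^sup>2) has_integral 2 * pi * K) {0..2 * pi}"
      "(\<lambda>k. (norm (taylor_coeff g k))\<^sup>2 * r ^ (2 * k)) sums K"
      using circle_mean_square_vec[OF g r] .
    have 1: "(\<Sum>k<N. (norm (taylor_coeff g k))\<^sup>2 * r ^ (2 * k)) \<le> K"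
      unfolding sums_unique[OF K(2)] by (rule sum_le_suminf[OF sums_summable[OF K(2)]]) (use r in auto)
    have "2 * pi * K \<le> 2 * pi * J"
      using r by (intro has_integral_le[OF K(1) J(1)] power_mono le) (auto simp: norm_mult)
    then have 2: "K \<le> J" by simp
    have "J \<le> ?F"
    proof (rule sums_le[OF _ J(2)])
      show "(\<lambda>k. (norm (taylor_coeff f k))\<^sup>2) sums ?F"
        unfolding norm_ell2_sq by (metis Rep_ell2_ell2_of f summable_Rep_ell2 summable_sums)
      show "(norm (taylor_coeff f k))\<^sup>2 * r ^ (2 * k) \<le> (norm (taylor_coeff f k))\<^sup>2" for k
        using r by (simp add: mult_left_le power_le_one)
    qed
    with 1 2 show ?thesis by linarith
  qed
  \<comment> \<open>A finite sum is continuous in \<open>r\<close>, so \<open>r\<close> can tend to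
    1 before the number of terms grows.\<close>
  have bound: "(\<Sum>k<N. (norm (taylor_coeff g k))\<^sup>2) \<le> ?F" for N
  proof (rule tendsto_upperbound)
    have "((\<lambda>r::real. \<Sum>k<N. (norm (taylor_coeff g k))\<^sup>2 * r ^ (2 * k))
        \<longlongrightarrow> (\<Sum>k<N. (norm (taylor_coeff g k))\<^sup>2 * 1 ^ (2 * k))) (at_left 1)"
      by (intro tendsto_intros)
    then show "((\<lambda>r::real. \<Sum>k<N. (norm (taylor_coeff g k))\<^sup>2 * r ^ (2 * k))
        \<longlongrightarrow> (\<Sum>k<N. (norm (taylor_coeff g k))\<^sup>2)) (at_left 1)" by simp
    show "\<forall>\<^sub>F r in at_left 1. (\<Sum>k<N. (norm (taylor_coeff g k))\<^sup>2 * r ^ (2 * k)) \<le> ?F"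
      using eventually_at_left_real[of 0 "1::real"] by (rule eventually_mono) (auto intro: r_bound)
  qed simp
  show gH: "g \<in> H2" using g summable_norm2_bounded(1)[OF bound] by (simp add: H2_def)
  have "(norm (ell2_of g))\<^sup>2 \<le> ?F"
    unfolding norm_ell2_sq[of "ell2_of g"] Rep_ell2_ell2_of[OF gH] by (rule summable_norm2_bounded(2)[OF bound])
  then show "norm (ell2_of g) \<le> norm (ell2_of f)" by (rule power2_le_imp_le) simp
qed

section \<open>Operators on the Hardy space\<close>

lemma onorm_less_1_contraction:
  fixes A :: "complex ^ 'n ^ 'm"
  assumes "onorm ((*v) A) < 1"
  shows "norm (A *v x) \<le> norm x"
proof -
  have "norm (A *v x) \<le> onorm ((*v) A) * norm x"
    by (rule onorm[OF matrix_vector_mul_bounded_linear])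
  also have "\<dots> \<le> 1 * norm x" using assms by (intro mult_right_mono) auto
  finally show ?thesis by simp
qed

lemma schur_class_contraction:
  "b \<in> schur_class \<Longrightarrow> z \<in> ball 0 1 \<Longrightarrow> norm (b z *v x) \<le> norm x"
  by (rule onorm_less_1_contraction) (auto simp: schur_class_def)

text \<open>Transport of an operator on functions to \<open>ell2\<close>; it sees \<open>T\<close>
  only on the representatives \<open>fun_of a\<close>.\<close>

definition H2_lift :: "((complex \<Rightarrow> complex ^ 'n) \<Rightarrow> (complex \<Rightarrow> complex ^ 'n)) \<Rightarrow>
    (complex ^ 'n) ell2 \<Rightarrow> (complex ^ 'n) ell2" where
  "H2_lift T a = ell2_of (T (fun_of a))"

lemma H2_operator_in_H2: "H2_operator T \<Longrightarrow> f \<in> H2 \<Longrightarrow> T f \<in> H2"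
  unfolding H2_operator_def by blast

lemma H2_operator_lin:
  "H2_operator T \<Longrightarrow> f \<in> H2 \<Longrightarrow> g \<in> H2 \<Longrightarrow>
    eq_on_disc (T (\<lambda>z. c *s f z + g z)) (\<lambda>z. c *s T f z + T g z)"
  unfolding H2_operator_def by blast

text \<open>An operator could react to values outside the disc. It does not: the difference
  \<open>h\<close> of two representatives has \<open>H2\<close> norm 0, so boundedness forces
  \<open>T h\<close> to vanish on the disc, and linearity transfers this to \<open>T f\<close> and
  \<open>T g\<close>.\<close>

lemma H2_operator_cong:
  assumes T: "H2_operator T" and fg: "f \<in> H2" "g \<in> H2" "eq_on_disc f g"
  shows "eq_on_disc (T f) (T g)"
proof -
  define h where "h = (\<lambda>z. (-1) *s g z + f z)"
  have h: "h \<in> H2" "ell2_of h = 0"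
    using ell2_of_lin[OF fg(2,1), of "-1"] ell2_of_cong[OF fg(3)] cscale_of_real[of "-1" "ell2_of g"]
    by (simp_all add: h_def)
  obtain C where "\<And>f. f \<in> H2 \<Longrightarrow> H2_norm (T f) \<le> C * H2_norm f"
    using T unfolding H2_operator_def by blast
  from this[OF h(1)] have "H2_norm (T h) \<le> 0" by (simp add: H2_norm_eq h)
  moreover have Th: "T h \<in> H2" by (rule H2_operator_in_H2[OF T h(1)])
  ultimately have "ell2_of (T h) = 0" by (simp add: H2_norm_eq)
  then have "T h z = 0" if "z \<in> ball 0 1" for z
    using fun_of_ell2_of[OF Th that] by simp
  moreover have "eq_on_disc (T h) (\<lambda>z. (-1) *s T g z + T f z)"
    unfolding h_def by (rule H2_operator_lin[OF T fg(2,1)])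
  ultimately show ?thesis
    by (simp add: eq_on_disc_def vec_eq_iff)
qed

lemma ell2_of_H2_operator:
  assumes "H2_operator T" "f \<in> H2"
  shows "ell2_of (T f) = H2_lift T (ell2_of f)"
proof -
  have "eq_on_disc (fun_of (ell2_of f)) f" using fun_of_ell2_of[OF assms(2)] by (simp add: eq_on_disc_def)
  from ell2_of_cong[OF H2_operator_cong[OF assms(1) fun_of_in_H2 assms(2) this]]
  show ?thesis unfolding H2_lift_def ..
qed

lemma fun_of_H2_lift:
  assumes "H2_operator T" "z \<in> ball 0 1"
  shows "fun_of (H2_lift T a) z = T (fun_of a) z"
  unfolding H2_lift_def by (rule fun_of_ell2_of[OF H2_operator_in_H2[OF assms(1) fun_of_in_H2] assms(2)])

lemma H2_lift_lin:
  assumes T: "H2_operator T"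
  shows "H2_lift T (cscale c a + d) = cscale c (H2_lift T a) + H2_lift T d"
proof -
  have in_H2: "T (fun_of a) \<in> H2" for a by (rule H2_operator_in_H2[OF T fun_of_in_H2])
  have "H2_lift T (cscale c a + d) = ell2_of (T (\<lambda>z. c *s fun_of a z + fun_of d z))"
    unfolding H2_lift_def
    by (rule ell2_of_cong[OF H2_operator_cong[OF T fun_of_in_H2 ell2_of_lin(1)[OF fun_of_in_H2 fun_of_in_H2]]])
      (simp add: eq_on_disc_def fun_of_cscale_add)
  also have "\<dots> = ell2_of (\<lambda>z. c *s T (fun_of a) z + T (fun_of d) z)"
    by (rule ell2_of_cong[OF H2_operator_lin[OF T fun_of_in_H2 fun_of_in_H2]])
  finally show ?thesis by (simp add: ell2_of_lin in_H2 H2_lift_def)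
qed

lemma cscale_one [simp]: "cscale 1 a = a"
  using cscale_of_real[of 1 a] by simp

lemma cscale_minus_one [simp]: "cscale (- 1) a = - a"
  using cscale_of_real[of "-1" a] by simp

lemma H2_lift_cscale:
  assumes "H2_operator T"
  shows "H2_lift T (cscale c a) = cscale c (H2_lift T a)"
  using H2_lift_lin[OF assms, of c a 0] H2_lift_lin[OF assms, of 1 0 0] by simp

lemma bounded_linear_H2_lift:
  assumes T: "H2_operator T"
  shows "bounded_linear (H2_lift T)"
proof -
  obtain C where C: "\<And>f. f \<in> H2 \<Longrightarrow> H2_norm (T f) \<le> C * H2_norm f"
    using T unfolding H2_operator_def by blast
  have in_H2: "T (fun_of a) \<in> H2" for a by (rule H2_operator_in_H2[OF T fun_of_in_H2])
  show ?thesis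
  proof (rule bounded_linear_intro[where K = C])
    show "H2_lift T (a + d) = H2_lift T a + H2_lift T d" for a d
      using H2_lift_lin[OF T, of 1 a d] by simp
    show "H2_lift T (r *\<^sub>R a) = r *\<^sub>R H2_lift T a" for r a
      using H2_lift_cscale[OF T, of "of_real r" a] by (simp add: cscale_of_real)
    show "norm (H2_lift T a) \<le> norm a * C" for a
      using C[OF fun_of_in_H2[of a]]
      by (simp add: H2_norm_eq in_H2 fun_of_in_H2 ell2_of_fun_of H2_lift_def mult.commute)
  qed
qed

lemma H2_operator_of_ell2:
  assumes "bounded_linear t" "\<And>c a. t (cscale c a) = cscale c (t a)"
  shows "H2_operator (\<lambda>f. fun_of (t (ell2_of f)))"
proof -
  obtain K where K: "\<And>a. norm (t a) \<le> norm a * K" using bounded_linear.bounded[OF assms(1)] by blast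
  have "fun_of (t (ell2_of (\<lambda>z. c *s f z + g z))) z = c *s fun_of (t (ell2_of f)) z + fun_of (t (ell2_of g)) z"
    if "f \<in> H2" "g \<in> H2" "z \<in> ball 0 1" for f g c z
    using that by (simp add: ell2_of_lin linear_add[OF bounded_linear.linear[OF assms(1)]] assms(2) fun_of_cscale_add del: mem_ball)
  moreover have "\<forall>f\<in>H2. H2_norm (fun_of (t (ell2_of f))) \<le> K * H2_norm f"
    using K by (auto simp: H2_norm_eq fun_of_in_H2 ell2_of_fun_of mult.commute)
  ultimately show ?thesis
    by (auto simp: H2_operator_def fun_of_in_H2 eq_on_disc_def)
qed

lemma H2_operator_mult_op:
  assumes b: "b \<in> schur_class"
  shows "H2_operator (mult_op b)"
    and "norm (H2_lift (mult_op b) a) \<le> norm a"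
proof -
  have hol: "(\<lambda>z. mult_op b f z $ i) holomorphic_on ball 0 1" if "f \<in> H2" for f i
    using b that unfolding mult_op_def matrix_vector_mult_def H2_def schur_class_def
    by (auto intro!: holomorphic_intros)
  have le: "norm (mult_op b f z) \<le> norm (f z)" if "z \<in> ball 0 1" for f z
    unfolding mult_op_def by (rule schur_class_contraction[OF b that])
  have "\<forall>f\<in>H2. H2_norm (mult_op b f) \<le> 1 * H2_norm f"
    using H2_dominated[OF _ hol le] by (simp add: H2_norm_eq)
  moreover have "mult_op b (\<lambda>z. c *s f z + g z) z = c *s mult_op b f z + mult_op b g z" for c f g z
    by (simp add: mult_op_def matrix_vector_right_distrib vector_scalar_commute)
  ultimately show "H2_operator (mult_op b)"
    using H2_dominated(1)[OF _ hol le] unfolding H2_operator_def eq_on_disc_def by blast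
  show "norm (H2_lift (mult_op b) a) \<le> norm a"
    using H2_dominated(2)[OF fun_of_in_H2 hol[OF fun_of_in_H2] le] by (simp add: H2_lift_def ell2_of_fun_of)
qed

lemma inner_H2_lift_eq:
  assumes T: "H2_operator T" and S: "H2_operator S"
    and adj: "\<forall>f\<in>H2. \<forall>g\<in>H2. H2_inner (T f) g = H2_inner f (S g)"
  shows "inner (H2_lift T a) c = inner a (H2_lift S c)"
proof -
  have in_H2: "T (fun_of a) \<in> H2" "S (fun_of a) \<in> H2" for a
    by (intro H2_operator_in_H2[OF T] H2_operator_in_H2[OF S] fun_of_in_H2)+
  have "H2_inner (T (fun_of a)) (fun_of c) = H2_inner (fun_of a) (S (fun_of c))"
    using adj fun_of_in_H2 by blast
  then show ?thesis by (simp add: H2_inner_eq in_H2 fun_of_in_H2 ell2_of_fun_of H2_lift_def)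
qed

lemma H2_inner_of_ell2:
  assumes T: "H2_operator T" and S: "\<And>c a. s (cscale c a) = cscale c (s a)"
    and adj: "\<And>a c. inner (H2_lift T a) c = inner a (s c)" and fg: "f \<in> H2" "g \<in> H2"
  shows "H2_inner (T f) g = H2_inner f (fun_of (s (ell2_of g)))"
proof -
  have "T f \<in> H2" by (rule H2_operator_in_H2[OF T fg(1)])
  then show ?thesis
    by (simp add: H2_inner_eq fg fun_of_in_H2 ell2_of_fun_of ell2_of_H2_operator[OF T] adj flip: S)
qed

text \<open>The adjoint of the lift in the real Hilbert space, read back on functions, is a witness
  for the choice in \<open>H2_adjoint\<close>.\<close>

lemma H2_adjoint_props:
  assumes T: "H2_operator T"
  shows "H2_operator (H2_adjoint T)"
    and "inner (H2_lift T a) c = inner a (H2_lift (H2_adjoint T) c)"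
proof -
  let ?P = "\<lambda>S. H2_operator S \<and> (\<forall>f\<in>H2. \<forall>g\<in>H2. H2_inner (T f) g = H2_inner f (S g))"
  obtain s where s: "bounded_linear s" "\<And>x y. inner (H2_lift T x) y = inner x (s y)"
    using hilbert_adjoint_exists[OF bounded_linear_H2_lift[OF T]] by blast
  \<comment> \<open>The real adjoint is a priori only real-linear. It inherits complex homogeneity
    from \<open>T\<close> by moving \<open>c\<close> to the other side of the pairing as
    \<open>cnj c\<close>.\<close>
  have sc: "s (cscale c a) = cscale c (s a)" for c a
  proof -
    have "inner x (s (cscale c a)) = inner x (cscale c (s a))" for x
      using inner_cscale_left[of "cnj c" "H2_lift T x" a] inner_cscale_left[of "cnj c" x "s a"]
        H2_lift_cscale[OF T, of "cnj c" x]
      by (simp flip: s(2))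
    then show ?thesis using vector_eq_ldot[of "s (cscale c a)" "cscale c (s a)"] by blast
  qed
  have "?P (\<lambda>f. fun_of (s (ell2_of f)))"
    using H2_operator_of_ell2[OF s(1) sc] H2_inner_of_ell2[OF T sc s(2)] by blast
  from someI[of ?P, OF this] have P: "?P (H2_adjoint T)" unfolding H2_adjoint_def .
  then show "H2_operator (H2_adjoint T)" by blast
  show "inner (H2_lift T a) c = inner a (H2_lift (H2_adjoint T) c)"
    using P by (intro inner_H2_lift_eq T) auto
qed

text \<open>Multiplication and its adjoint are contractions, so the square root construction applies
  to their product and gives a witness for the choice in \<open>H2_sqrt\<close>. The last claim
  computes the square of the root on Szego kernels, where the adjoint is explicit.\<close>

lemma dBR_op_props:
  assumes b: "b \<in> schur_class"
  shows "H2_operator (dBR_op b)"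
    and "inner (H2_lift (dBR_op b) x) y = inner x (H2_lift (dBR_op b) y)"
    and "w \<in> ball 0 1 \<Longrightarrow> z \<in> ball 0 1 \<Longrightarrow>
      fun_of (H2_lift (dBR_op b) (H2_lift (dBR_op b) (szego w e))) z =
      inverse (1 - z * cnj w) *s (e - b z *v (mat_adj (b w) *v e))"
proof -
  define T where "T = mult_op b"
  define S where "S = H2_adjoint T"
  have T: "H2_operator T" unfolding T_def by (rule H2_operator_mult_op[OF b])
  have S: "H2_operator S" unfolding S_def by (rule H2_adjoint_props[OF T])
  define t where "t = H2_lift T"
  define s where "s = H2_lift S"
  have ts: "inner (t a) c = inner a (s c)" for a c
    unfolding t_def s_def S_def by (rule H2_adjoint_props[OF T])
  have nt: "norm (t a) \<le> norm a" for a unfolding t_def T_def by (rule H2_operator_mult_op[OF b])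
  have ns: "norm (s c) \<le> norm c" for c
  proof (cases "s c = 0")
    case False
    have "norm (s c) * norm (s c) = inner (t (s c)) c"
      unfolding ts by (simp add: power2_norm_eq_inner[symmetric] power2_eq_square[symmetric])
    also have "\<dots> \<le> norm (t (s c)) * norm c" by (rule norm_cauchy_schwarz)
    also have "\<dots> \<le> norm (s c) * norm c" by (intro mult_right_mono nt) auto
    finally show ?thesis using False by simp
  qed simp
  define A where "A = (\<lambda>f z. f z - mult_op b (H2_adjoint (mult_op b) f) z)"
  have A: "A f \<in> H2" "ell2_of (A f) = ell2_of f - t (s (ell2_of f))" if f: "f \<in> H2" for f
  proof -
    have Sf: "S f \<in> H2" and TSf: "T (S f) \<in> H2" using H2_operator_in_H2 T S f by blast+
    have "A f = (\<lambda>z. (-1) *s T (S f) z + f z)"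
      by (simp add: A_def T_def S_def vec_eq_iff fun_eq_iff)
    then show "A f \<in> H2" "ell2_of (A f) = ell2_of f - t (s (ell2_of f))"
      using ell2_of_lin[OF TSf f, of "-1"] cscale_of_real[of "-1"]
      by (simp_all add: ell2_of_H2_operator[OF T Sf] ell2_of_H2_operator[OF S f] t_def s_def)
  qed
  have bl: "bounded_linear (\<lambda>a. t (s a))"
    unfolding t_def s_def by (intro bounded_linear_compose[OF bounded_linear_H2_lift[OF T]] bounded_linear_H2_lift S)
  let ?P = "\<lambda>R. H2_operator R \<and>
        (\<forall>f\<in>H2. \<forall>g\<in>H2. H2_inner (R f) g = H2_inner f (R g)) \<and>
        (\<forall>f\<in>H2. 0 \<le> Re (H2_inner (R f) f)) \<and>
        (\<forall>f\<in>H2. eq_on_disc (R (R f)) (A f))"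
  have ts_sym: "inner (t (s x)) y = inner x (t (s y))" for x y
    unfolding ts by (metis ts inner_commute)
  have "\<exists>R. ?P R"
  proof -
    obtain r0 where r0: "bounded_linear r0" "\<And>x y. inner (r0 x) y = inner x (r0 y)"
      "\<And>x. 0 \<le> inner (r0 x) x" "\<And>x. r0 (r0 x) = x - t (s x)"
      "\<forall>J. bounded_linear J \<longrightarrow> (\<forall>x. J (t (s x)) = t (s (J x))) \<longrightarrow> (\<forall>x. J (r0 x) = r0 (J x))"
      using sqrt_one_minus_exists[OF bl order_trans[OF nt ns] ts_sym] by blast
    have r0c: "r0 (cscale c a) = cscale c (r0 a)" for c a
    proof -
      have "\<forall>x. cscale c (t (s x)) = t (s (cscale c x))"
        by (simp add: t_def s_def H2_lift_cscale T S)
      with r0(5) bounded_linear_cscale[of c] show ?thesis by metis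
    qed
    define R0 where "R0 f = fun_of (r0 (ell2_of f))" for f
    have R0: "H2_operator R0" unfolding R0_def by (rule H2_operator_of_ell2[OF r0(1) r0c])
    have lift_R0: "H2_lift R0 a = r0 a" for a by (simp add: H2_lift_def R0_def ell2_of_fun_of)
    have "?P R0"
    proof (intro conjI ballI)
      show "H2_operator R0" by fact
      show "H2_inner (R0 f) g = H2_inner f (R0 g)" if "f \<in> H2" "g \<in> H2" for f g
        using H2_inner_of_ell2[OF R0 r0c _ that] by (simp add: lift_R0 r0(2) R0_def)
      show "0 \<le> Re (H2_inner (R0 f) f)" if "f \<in> H2" for f
        using that by (simp add: H2_inner_eq R0_def fun_of_in_H2 ell2_of_fun_of r0(3))
      show "eq_on_disc (R0 (R0 f)) (A f)" if "f \<in> H2" for f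
        using fun_of_ell2_of[OF A(1)[OF that]] by (simp add: eq_on_disc_def R0_def ell2_of_fun_of r0(4) A(2)[OF that])
    qed
    then show ?thesis by blast
  qed
  from someI_ex[OF this] have P: "?P (dBR_op b)"
    unfolding dBR_op_def H2_sqrt_def A_def .
  define R where "R = dBR_op b"
  define r where "r = H2_lift R"
  have R: "H2_operator R" using P by (simp add: R_def)
  have sa: "inner (r x) y = inner x (r y)" for x y
    unfolding r_def using P by (intro inner_H2_lift_eq R) (simp add: R_def)
  have rr: "r (r a) = a - t (s a)" for a
  proof -
    have "r (r a) = ell2_of (R (R (fun_of a)))"
      unfolding r_def ell2_of_H2_operator[OF R H2_operator_in_H2[OF R fun_of_in_H2]]
      by (simp add: H2_lift_def)
    also have "\<dots> = ell2_of (A (fun_of a))"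
      using P fun_of_in_H2[of a] by (intro ell2_of_cong) (simp add: R_def)
    finally show ?thesis by (simp add: A fun_of_in_H2 ell2_of_fun_of)
  qed
  \<comment> \<open>Pairing with a Szego kernel is evaluation at \<open>w\<close>, so the adjoint of
    multiplication by \<open>b\<close> sends a kernel to the kernel at the same point in direction
    \<open>b(w)^* e\<close>. This produces the numerator of the kernel of the de Branges--Rovnyak
    space.\<close>
  have s_szego: "s (szego w e) = szego w (mat_adj (b w) *v e)" if w: "w \<in> ball 0 1" for w e
  proof -
    have "inner a (s (szego w e)) = inner a (szego w (mat_adj (b w) *v e))" for a
      by (simp add: ts[symmetric] inner_szego[OF w] t_def fun_of_H2_lift[OF T w])
        (simp add: T_def mult_op_def inner_mat_left)
    then show ?thesis using vector_eq_ldot[of "s (szego w e)"] by blast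
  qed
  show "H2_operator (dBR_op b)" using R by (simp add: R_def)
  show "inner (H2_lift (dBR_op b) x) y = inner x (H2_lift (dBR_op b) y)"
    using sa by (simp add: r_def R_def)
  assume w: "w \<in> ball 0 1" and z: "z \<in> ball 0 1"
  have t_fun: "fun_of (t a) z = b z *v fun_of a z" for a
    unfolding t_def fun_of_H2_lift[OF T z] by (simp add: T_def mult_op_def)
  have "r (r (szego w e)) = cscale (-1) (t (szego w (mat_adj (b w) *v e))) + szego w e"
    by (simp add: rr s_szego[OF w])
  then have "fun_of (r (r (szego w e))) z
      = (-1) *s (b z *v (inverse (1 - z * cnj w) *s (mat_adj (b w) *v e))) + inverse (1 - z * cnj w) *s e"
    by (simp only: fun_of_cscale_add[OF z] t_fun fun_of_szego[OF w z])
  then show "fun_of (H2_lift (dBR_op b) (H2_lift (dBR_op b) (szego w e))) z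
      = inverse (1 - z * cnj w) *s (e - b z *v (mat_adj (b w) *v e))"
    by (simp add: r_def R_def vector_scalar_commute vector_ssub_ldistrib)
qed

section \<open>The de Branges--Rovnyak space\<close>

locale schur_function =
  fixes b :: "complex \<Rightarrow> complex ^ 'n ^ 'n"
  assumes schur: "b \<in> schur_class"
begin

abbreviation R :: "(complex ^ 'n) ell2 \<Rightarrow> (complex ^ 'n) ell2" where
  "R \<equiv> H2_lift (dBR_op b)"

text \<open>\<open>R\<close> maps \<open>root_kernel w e\<close> to the reproducing kernel of \<open>dBR_space b\<close> at \<open>w\<close> in direction \<open>e\<close>.\<close>

definition root_kernel :: "complex \<Rightarrow> complex ^ 'n \<Rightarrow> (complex ^ 'n) ell2" where
  "root_kernel w e = R (szego w e)"

text \<open>The closure of the range of \<open>R\<close>, that is, the orthogonal complement of its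
  kernel; on it the norm of a vector is the range norm of its image. A real span suffices because
  the generating set is stable under \<open>cscale\<close>.\<close>

definition initial_space :: "(complex ^ 'n) ell2 set" where
  "initial_space = closure (span (\<Union>w\<in>ball 0 1. range (root_kernel w)))"

lemmas dBR_operator = dBR_op_props(1)[OF schur]
lemmas R_symmetric = dBR_op_props(2)[OF schur]
lemmas bounded_linear_R = bounded_linear_H2_lift[OF dBR_operator]
lemmas R_cscale = H2_lift_cscale[OF dBR_operator]

lemma R_add: "R (x + y) = R x + R y"
  by (rule linear_add[OF bounded_linear.linear[OF bounded_linear_R]])

lemma R_diff: "R (x - y) = R x - R y"
  by (rule linear_diff[OF bounded_linear.linear[OF bounded_linear_R]])

lemma fun_of_R_root_kernel:
  "w \<in> ball 0 1 \<Longrightarrow> z \<in> ball 0 1 \<Longrightarrow>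
    fun_of (R (root_kernel w e)) z = inverse (1 - z * cnj w) *s (e - b z *v (mat_adj (b w) *v e))"
  unfolding root_kernel_def by (rule dBR_op_props(3)[OF schur])

lemma inner_root_kernel:
  "w \<in> ball 0 1 \<Longrightarrow> inner a (root_kernel w e) = inner (fun_of (R a) w) e"
  by (simp add: root_kernel_def R_symmetric[symmetric] inner_szego del: mem_ball)

lemma cscale_root_kernel: "cscale c (root_kernel w e) = root_kernel w (c *s e)"
  by (simp add: root_kernel_def R_cscale[symmetric] cscale_szego)

lemma root_kernel_add: "root_kernel w (x + y) = root_kernel w x + root_kernel w y"
  by (simp add: root_kernel_def R_add szego_add)

text \<open>The quotient in the Caratheodory condition is the squared norm of a Hilbert space
  vector, so the condition becomes boundedness of root kernels along a sequence.\<close>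

lemma power2_norm_root_kernel:
  assumes w: "w \<in> ball 0 1"
  shows "(norm (root_kernel w e))\<^sup>2 = ((norm e)\<^sup>2 - (norm (mat_adj (b w) *v e))\<^sup>2) / (1 - (cmod w)\<^sup>2)"
proof -
  have eq: "inverse (1 - w * cnj w) = of_real (1 / (1 - (cmod w)\<^sup>2))"
    by (simp add: complex_norm_square[symmetric] inverse_eq_divide flip: of_real_power)
  have "(norm (root_kernel w e))\<^sup>2 = inner (inverse (1 - w * cnj w) *s (e - b w *v (mat_adj (b w) *v e))) e"
    by (simp add: power2_norm_eq_inner inner_root_kernel[OF w] fun_of_R_root_kernel[OF w w])
  also have "\<dots> = (inner e e - inner (b w *v (mat_adj (b w) *v e)) e) / (1 - (cmod w)\<^sup>2)"
    by (simp add: eq inner_eq_Re_cinner cinner_smult_left cinner_diff_left diff_divide_distrib)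
  finally show ?thesis
    by (simp add: inner_mat_left power2_norm_eq_inner)
qed

lemma root_kernel_in_initial_space: "w \<in> ball 0 1 \<Longrightarrow> root_kernel w e \<in> initial_space"
  unfolding initial_space_def by (intro subsetD[OF closure_subset] span_base) blast

lemma subspace_initial_space: "subspace initial_space"
  unfolding subspace_def
proof (intro conjI ballI allI)
  let ?S = "span (\<Union>w\<in>ball 0 1. range (root_kernel w))"
  show "0 \<in> initial_space"
    unfolding initial_space_def using span_zero closure_subset by blast
  fix x y assume "x \<in> initial_space" "y \<in> initial_space"
  then obtain X Y where XY: "\<And>n. X n \<in> ?S" "X \<longlonglongrightarrow> x" "\<And>n. Y n \<in> ?S" "Y \<longlonglongrightarrow> y"
    unfolding initial_space_def closure_sequential by blast
  show "x + y \<in> initial_space"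
    unfolding initial_space_def closure_sequential
    using XY by (intro exI[of _ "\<lambda>n. X n + Y n"]) (auto intro: span_add tendsto_add)
  show "c *\<^sub>R x \<in> initial_space" for c
    unfolding initial_space_def closure_sequential
    using XY by (intro exI[of _ "\<lambda>n. c *\<^sub>R X n"]) (auto intro: span_scale intro!: tendsto_intros)
qed

lemma cscale_in_initial_space:
  assumes "h \<in> initial_space"
  shows "cscale c h \<in> initial_space"
proof -
  let ?A = "\<Union>w\<in>ball 0 1. range (root_kernel w)"
  have "cscale c ` initial_space \<subseteq> closure (cscale c ` span ?A)"
    unfolding initial_space_def by (rule closure_bounded_linear_image_subset[OF bounded_linear_cscale])
  also have "cscale c ` span ?A = span (cscale c ` ?A)"
    by (rule linear_span_image[OF bounded_linear.linear[OF bounded_linear_cscale], symmetric])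
  also have "closure \<dots> \<subseteq> initial_space"
    unfolding initial_space_def
  proof (intro closure_mono span_mono subsetI)
    fix x assume "x \<in> cscale c ` ?A"
    then obtain w e where "w \<in> ball 0 1" "x = root_kernel w (c *s e)"
      by (auto simp: cscale_root_kernel simp del: mem_ball)
    then show "x \<in> ?A" by blast
  qed
  finally show ?thesis using assms by blast
qed

lemma initial_space_subset:
  assumes "closed W" "subspace W" "\<And>w e. w \<in> ball 0 1 \<Longrightarrow> root_kernel w e \<in> W"
  shows "initial_space \<subseteq> W"
  unfolding initial_space_def using assms by (intro closure_minimal span_minimal) auto

text \<open>By symmetry of \<open>R\<close>, pairing \<open>k\<close> with a root kernel evaluates
  \<open>R k\<close>; orthogonality then extends to the closed span.\<close>

lemma initial_space_orth_kernel:
  assumes "h \<in> initial_space" "R k = 0"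
  shows "inner k h = 0"
proof -
  have "initial_space \<subseteq> {h. inner k h = 0}"
  proof (rule initial_space_subset)
    show "closed {h. inner k h = 0}" by (rule closed_hyperplane)
    show "subspace {h. inner k h = 0}" by (rule subspace_hyperplane)
    show "root_kernel w e \<in> {h. inner k h = 0}" if "w \<in> ball 0 1" for w e
      by (simp add: inner_root_kernel[OF that] assms(2))
  qed
  with assms(1) show ?thesis by blast
qed

text \<open>Any two preimages differ by an element of the kernel of \<open>R\<close>, which is
  orthogonal to \<open>h\<close>. By Pythagoras the infimum in the range norm is attained at
  \<open>h\<close>.\<close>

lemma dBR_norm_eq:
  assumes h: "h \<in> initial_space" and f: "eq_on_disc (fun_of (R h)) f"
  shows "dBR_norm b f = norm h"
proof -
  have pre: "h' \<in> dBR_preimages b f \<longleftrightarrow> h' \<in> H2 \<and> R (ell2_of h') = R h" for h'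
  proof (cases "h' \<in> H2")
    case True
    have 1: "dBR_op b h' \<in> H2" by (rule H2_operator_in_H2[OF dBR_operator True])
    have 2: "ell2_of (dBR_op b h') = R (ell2_of h')" by (rule ell2_of_H2_operator[OF dBR_operator True])
    have 3: "ell2_of f = R h" using ell2_of_cong[OF f] by (simp add: ell2_of_fun_of)
    have "eq_on_disc (dBR_op b h') f \<longleftrightarrow> R (ell2_of h') = R h"
    proof
      assume "R (ell2_of h') = R h"
      then show "eq_on_disc (dBR_op b h') f"
        using f fun_of_ell2_of[OF 1] by (simp add: 2 eq_on_disc_def)
    qed (use ell2_of_cong 2 3 in metis)
    with True show ?thesis by (simp add: dBR_preimages_def)
  qed (simp add: dBR_preimages_def)
  show ?thesis
    unfolding dBR_norm_def
  proof (rule cInf_eq_minimum)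
    have "fun_of h \<in> dBR_preimages b f" by (simp add: pre fun_of_in_H2 ell2_of_fun_of)
    moreover have "norm h = H2_norm (fun_of h)" by (simp add: H2_norm_eq fun_of_in_H2 ell2_of_fun_of)
    ultimately show "norm h \<in> H2_norm ` dBR_preimages b f" by blast
    fix x assume "x \<in> H2_norm ` dBR_preimages b f"
    then obtain h' where h': "h' \<in> H2" "R (ell2_of h') = R h" "x = norm (ell2_of h')"
      by (auto simp: pre H2_norm_eq)
    have "inner (ell2_of h' - h) h = 0"
      by (rule initial_space_orth_kernel[OF h]) (simp add: R_diff h')
    then have "(norm h)\<^sup>2 + (norm (ell2_of h' - h))\<^sup>2 = (norm (ell2_of h'))\<^sup>2"
      by (simp add: power2_norm_eq_inner inner_diff_left inner_diff_right inner_commute)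
    then have "(norm h)\<^sup>2 \<le> (norm (ell2_of h'))\<^sup>2" by (smt (verit) zero_le_power2)
    then show "norm h \<le> x" using h'(3) by (simp add: power2_le_iff_abs_le)
  qed
qed

text \<open>The four combinations \<open>h + cscale c k\<close> of the polarization formula stay in
  \<open>initial_space\<close>, so all four range norms are norms in \<open>ell2\<close>.\<close>

lemma dBR_inner_eq:
  assumes h: "h \<in> initial_space" and k: "k \<in> initial_space"
    and f: "eq_on_disc (fun_of (R h)) f" and g: "eq_on_disc (fun_of (R k)) g"
  shows "dBR_inner b f g = Complex (inner h k) (inner h (cscale \<i> k))"
proof -
  have n: "(dBR_norm b (\<lambda>z. f z + c *s g z))\<^sup>2 = (norm h)\<^sup>2 + (cmod c)\<^sup>2 * (norm k)\<^sup>2 + 2 * inner h (cscale c k)" for c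
  proof -
    have "h + cscale c k \<in> initial_space"
      using subspace_add[OF subspace_initial_space h cscale_in_initial_space[OF k]] .
    moreover have "eq_on_disc (fun_of (R (h + cscale c k))) (\<lambda>z. f z + c *s g z)"
      using f g fun_of_cscale_add[of _ c "R k" "R h"]
      by (simp add: eq_on_disc_def R_add R_cscale add.commute[of h] add.commute[of "R h"])
    ultimately have "dBR_norm b (\<lambda>z. f z + c *s g z) = norm (h + cscale c k)"
      by (rule dBR_norm_eq)
    moreover have "(norm (h + cscale c k))\<^sup>2 = (norm h)\<^sup>2 + (norm (cscale c k))\<^sup>2 + 2 * inner h (cscale c k)"
      unfolding power2_norm_eq_inner by (simp add: inner_add_left inner_add_right inner_commute)
    ultimately show ?thesis by (simp add: norm_cscale power_mult_distrib)
  qed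
  have c3: "cscale (- \<i>) k = - cscale \<i> k"
    using cscale_cscale[of "-1" \<i> k] by simp
  have s4: "(\<Sum>j<4. F j) = F 0 + F 1 + F 2 + F 3" for F :: "nat \<Rightarrow> complex"
    by (simp add: eval_nat_numeral)
  have p: "\<i> ^ 2 = -1" "\<i> ^ 3 = - \<i>" by (simp_all add: power2_eq_square power3_eq_cube)
  show ?thesis
    unfolding dBR_inner_def s4 n p power_0 power_one_right
    by (simp add: c3 complex_eq_iff)
qed

end

section \<open>Non-tangential limits and boundary vectors\<close>

lemma eventually_at_nt:
  "eventually P (at_nt \<zeta>) \<longleftrightarrow> (\<forall>t>1. eventually P (at \<zeta> within stolz t \<zeta>))"
  by (auto simp: at_nt_def eventually_Sup)

lemma tendsto_at_nt_stolz: "(f \<longlongrightarrow> l) (at_nt \<zeta>) \<Longrightarrow> t > 1 \<Longrightarrow> (f \<longlongrightarrow> l) (at \<zeta> within stolz t \<zeta>)"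
  by (auto simp: tendsto_def eventually_at_nt)

lemma tendsto_at_ntI:
  "(\<And>t. t > 1 \<Longrightarrow> (f \<longlongrightarrow> l) (at \<zeta> within stolz t \<zeta>)) \<Longrightarrow> (f \<longlongrightarrow> l) (at_nt \<zeta>)"
  by (auto simp: tendsto_def eventually_at_nt)

lemma stolz_subset_ball: "z \<in> stolz t \<zeta> \<Longrightarrow> z \<in> ball 0 1"
  by (simp add: stolz_def)

lemma eventually_at_stolz: "\<forall>\<^sub>F z in at \<zeta> within stolz t \<zeta>. z \<in> stolz t \<zeta>"
  by (simp add: eventually_at_filter)

lemma eventually_at_nt_ball: "\<forall>\<^sub>F z in at_nt \<zeta>. z \<in> ball 0 1"
  unfolding eventually_at_nt
  by (intro allI impI) (rule eventually_mono[OF eventually_at_stolz stolz_subset_ball])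

text \<open>On the radius to \<zeta> the distance to \<zeta> equals \<open>1 - cmod z\<close>, so
  radial points lie in every Stolz region with \<open>t > 1\<close>.\<close>

lemma at_within_stolz_neq_bot:
  assumes "cmod \<zeta> = 1" "t > 1"
  shows "at \<zeta> within stolz t \<zeta> \<noteq> bot"
  unfolding trivial_limit_within islimpt_approachable not_not
proof (intro allI impI)
  fix e :: real assume e: "e > 0"
  define d where "d = min (e / 2) (1 / 2)"
  have d: "0 < d" "d < e" "d < 1" using e by (auto simp: d_def)
  have dist: "cmod (of_real (1 - d) * \<zeta> - \<zeta>) = d"
  proof -
    have "of_real (1 - d) * \<zeta> - \<zeta> = of_real (- d) * \<zeta>" by (simp add: algebra_simps)
    then show ?thesis using d assms by (simp add: norm_mult del: of_real_minus)
  qed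
  have nrm: "cmod (of_real (1 - d) * \<zeta>) = 1 - d"
    using d assms unfolding norm_mult norm_of_real by simp
  show "\<exists>x'\<in>stolz t \<zeta>. x' \<noteq> \<zeta> \<and> dist x' \<zeta> < e"
  proof (intro bexI conjI)
    show "of_real (1 - d) * \<zeta> \<in> stolz t \<zeta>"
      unfolding stolz_def using d assms dist nrm by (simp del: of_real_diff)
    show "dist (of_real (1 - d) * \<zeta>) \<zeta> < e" using dist d by (simp add: dist_norm)
    show "of_real (1 - d) * \<zeta> \<noteq> \<zeta>" using dist d by force
  qed
qed

lemma at_nt_neq_bot:
  assumes "cmod \<zeta> = 1"
  shows "at_nt \<zeta> \<noteq> bot"
  using at_within_stolz_neq_bot[OF assms, of 2] eventually_at_nt[of "\<lambda>_. False" \<zeta>]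
  by (auto simp: trivial_limit_def)

definition julia_quotient :: "(complex \<Rightarrow> complex ^ 'n ^ 'n) \<Rightarrow> complex ^ 'n \<Rightarrow> complex \<Rightarrow> real" where
  "julia_quotient b x z = ((norm x)\<^sup>2 - (norm (mat_adj (b z) *v x))\<^sup>2) / (1 - (cmod z)\<^sup>2)"

text \<open>Eventually for \<open>at_nt\<close> means eventually in every Stolz region. A finite
  liminf therefore makes some lower bound \<open>B\<close> fail frequently in one single region, and
  the sequence is picked there.\<close>

lemma caratheodory_cond_sequence:
  assumes "caratheodory_cond b \<zeta> x"
  shows "\<exists>t>1. \<exists>B. \<exists>Z::nat \<Rightarrow> complex.
    (\<forall>n. Z n \<in> stolz t \<zeta> \<and> Z n \<noteq> \<zeta> \<and> julia_quotient b x (Z n) \<le> B) \<and> Z \<longlonglongrightarrow> \<zeta>"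
proof -
  let ?L = "Liminf (at_nt \<zeta>) (\<lambda>z. ereal (julia_quotient b x z))"
  have "?L < \<infinity>" using assms by (simp add: caratheodory_cond_def julia_quotient_def)
  then obtain B :: nat where B: "?L < ereal (real B)"
    by (auto simp: less_PInf_Ex_of_nat)
  have "\<not> (\<forall>\<^sub>F z in at_nt \<zeta>. ereal (real B) \<le> ereal (julia_quotient b x z))"
    using Liminf_bounded[of "ereal (real B)" "\<lambda>z. ereal (julia_quotient b x z)" "at_nt \<zeta>"] B by auto
  then obtain t where t: "t > 1" "\<not> (\<forall>\<^sub>F z in at \<zeta> within stolz t \<zeta>. real B \<le> julia_quotient b x z)"
    by (auto simp: eventually_at_nt)
  have "\<exists>z\<in>stolz t \<zeta>. z \<noteq> \<zeta> \<and> dist z \<zeta> < inverse (real (Suc n)) \<and> julia_quotient b x z \<le> real B" for n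
  proof -
    have "inverse (real (Suc n)) > 0" by simp
    then show ?thesis using t(2) unfolding eventually_at by (meson le_cases)
  qed
  then obtain Z where Z: "\<And>n. Z n \<in> stolz t \<zeta>" "\<And>n. Z n \<noteq> \<zeta>" "\<And>n. dist (Z n) \<zeta> < inverse (real (Suc n))"
    "\<And>n. julia_quotient b x (Z n) \<le> real B" by metis
  have "Z \<longlonglongrightarrow> \<zeta>"
  proof (rule metric_LIMSEQ_I)
    fix e :: real assume "e > 0"
    then obtain N where N: "inverse (real (Suc N)) < e" using reals_Archimedean by blast
    have "dist (Z n) \<zeta> < e" if "n \<ge> N" for n
    proof -
      have "inverse (real (Suc n)) \<le> inverse (real (Suc N))"
        using that by (intro le_imp_inverse_le) auto
      then show ?thesis using Z(3)[of n] N by linarith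
    qed
    then show "\<exists>no. \<forall>n\<ge>no. dist (Z n) \<zeta> < e" by blast
  qed
  with t(1) Z show ?thesis by blast
qed

lemma caratheodory_condI:
  assumes "cmod \<zeta> = 1" "t > 1" "\<forall>\<^sub>F z in at \<zeta> within stolz t \<zeta>. julia_quotient b x z \<le> B"
  shows "caratheodory_cond b \<zeta> x"
proof -
  let ?L = "Liminf (at_nt \<zeta>) (\<lambda>z. ereal (julia_quotient b x z))"
  have "?L \<le> ereal B"
  proof (rule ccontr)
    assume "\<not> ?L \<le> ereal B"
    then have "\<forall>\<^sub>F z in at_nt \<zeta>. ereal B < ereal (julia_quotient b x z)"
      by (intro less_LiminfD) simp
    then have "\<forall>\<^sub>F z in at \<zeta> within stolz t \<zeta>. B < julia_quotient b x z"
      using assms(2) by (simp add: eventually_at_nt)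
    with assms(3) have "\<forall>\<^sub>F z in at \<zeta> within stolz t \<zeta>. False"
      by eventually_elim simp
    then show False using at_within_stolz_neq_bot[OF assms(1,2)] by (simp add: trivial_limit_def)
  qed
  then have "?L < \<infinity>" by (rule le_less_trans) simp
  then show ?thesis unfolding caratheodory_cond_def julia_quotient_def .
qed

lemma tendsto_vec_smult:
  fixes f :: "'b \<Rightarrow> complex" and g :: "'b \<Rightarrow> complex ^ 'n"
  assumes "(f \<longlongrightarrow> c) F" "(g \<longlongrightarrow> v) F"
  shows "((\<lambda>z. f z *s g z) \<longlongrightarrow> c *s v) F"
  by (intro vec_tendstoI) (auto intro!: tendsto_intros tendsto_vec_nth assms)

lemma tendsto_mat_vec:
  fixes g :: "'b \<Rightarrow> complex ^ 'n"
  assumes "(g \<longlongrightarrow> v) F"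
  shows "((\<lambda>z. A *v g z) \<longlongrightarrow> A *v v) F"
  using bounded_linear.tendsto[OF matrix_vector_mul_bounded_linear assms] .

lemma one_minus_mult_cnj_neq_0:
  assumes "cmod z < 1" "cmod w \<le> 1"
  shows "1 - z * cnj w \<noteq> 0"
proof
  assume "1 - z * cnj w = 0"
  then have "cmod (z * cnj w) = 1" by simp
  moreover have "cmod z * cmod w \<le> cmod z * 1" using assms by (intro mult_left_mono) auto
  ultimately show False using assms by (simp add: norm_mult)
qed

lemma cmod_one_minus_mult_cnj:
  assumes "cmod \<zeta> = 1"
  shows "cmod (1 - z * cnj \<zeta>) = cmod (z - \<zeta>)"
proof -
  have "1 - z * cnj \<zeta> = (\<zeta> - z) * cnj \<zeta>"
    using assms complex_norm_square[of \<zeta>] by (simp add: algebra_simps)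
  then show ?thesis using assms by (simp add: norm_mult norm_minus_commute)
qed

section \<open>Root kernels near a boundary point\<close>

context schur_function
begin

lemma julia_quotient_eq: "z \<in> ball 0 1 \<Longrightarrow> julia_quotient b x z = (norm (root_kernel z x))\<^sup>2"
  unfolding julia_quotient_def by (rule power2_norm_root_kernel[symmetric])

lemma tendsto_kernel:
  assumes z: "z \<in> ball 0 1" and \<zeta>: "cmod \<zeta> \<le> 1"
    and w: "(w \<longlongrightarrow> \<zeta>) F" and u: "((\<lambda>i. mat_adj (b (w i)) *v x) \<longlongrightarrow> u) F"
  shows "((\<lambda>i. inverse (1 - z * cnj (w i)) *s (x - b z *v (mat_adj (b (w i)) *v x)))
    \<longlongrightarrow> inverse (1 - z * cnj \<zeta>) *s (x - b z *v u)) F"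
  using one_minus_mult_cnj_neq_0[of z \<zeta>] z \<zeta>
  by (intro tendsto_vec_smult tendsto_intros tendsto_mat_vec w u) auto

text \<open>Pairing with \<open>root_kernel z e\<close> evaluates the image under \<open>R\<close>
  at \<open>z\<close>, where the reproducing kernels converge explicitly. The cluster vector must
  therefore reproduce that limit at every \<open>z\<close>.\<close>

lemma boundary_vector_exists:
  assumes \<zeta>: "cmod \<zeta> = 1" and Z: "\<And>n::nat. Z n \<in> ball 0 1" "Z \<longlonglongrightarrow> \<zeta>"
    and bd: "\<And>n. julia_quotient b x (Z n) \<le> B"
    and u: "(\<lambda>n. mat_adj (b (Z n)) *v x) \<longlonglongrightarrow> u"
  obtains h where "h \<in> initial_space"
    "\<And>z. z \<in> ball 0 1 \<Longrightarrow> fun_of (R h) z = inverse (1 - z * cnj \<zeta>) *s (x - b z *v u)"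
proof -
  define X where "X n = root_kernel (Z n) x" for n
  have "norm (X n) \<le> sqrt B" for n
    using bd[of n] by (simp add: julia_quotient_eq[OF Z(1)] X_def real_le_rsqrt)
  then obtain h where h: "h \<in> closure (convex hull (range X))"
    "\<And>v c. (\<lambda>n. inner (X n) v) \<longlonglongrightarrow> c \<Longrightarrow> inner h v = c"
    using bounded_seq_convex_cluster[of X "sqrt B"] by blast
  have "convex hull (range X) \<subseteq> initial_space"
    by (intro hull_minimal subspace_imp_convex subspace_initial_space)
      (auto simp: X_def intro: root_kernel_in_initial_space Z(1) simp del: mem_ball)
  moreover have "closed initial_space" by (simp add: initial_space_def)
  ultimately have "h \<in> initial_space" using h(1) closure_minimal by blast
  moreover have "fun_of (R h) z = inverse (1 - z * cnj \<zeta>) *s (x - b z *v u)" if z: "z \<in> ball 0 1" for z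
  proof -
    have "inner (fun_of (R h) z) e = inner (inverse (1 - z * cnj \<zeta>) *s (x - b z *v u)) e" for e
    proof -
      have "(\<lambda>n. inner (X n) (root_kernel z e)) \<longlonglongrightarrow> inner (inverse (1 - z * cnj \<zeta>) *s (x - b z *v u)) e"
        using \<zeta> unfolding X_def inner_root_kernel[OF z] fun_of_R_root_kernel[OF Z(1) z]
        by (intro tendsto_inner tendsto_const tendsto_kernel z Z(2) u) auto
      from h(2)[OF this] show ?thesis by (simp add: inner_root_kernel[OF z])
    qed
    then show ?thesis using vector_eq_rdot by blast
  qed
  ultimately show thesis using that by blast
qed

text \<open>Julia's inequality: the defect \<open>\<parallel>x\<parallel>\<^sup>2 - \<parallel>b(z)\<^sup>*x\<parallel>\<^sup>2\<close> is at most
  \<open>2 Re \<langle>x - b(z)u, x\<rangle>\<close>, which is linear in \<open>root_kernel z x\<close>.\<close>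

lemma root_kernel_bound:
  assumes \<zeta>: "cmod \<zeta> = 1" and z: "z \<in> ball 0 1" and u: "norm u = norm x"
    and h: "\<And>z. z \<in> ball 0 1 \<Longrightarrow> fun_of (R h) z = inverse (1 - z * cnj \<zeta>) *s (x - b z *v u)"
  shows "norm (root_kernel z x) * (1 - (cmod z)\<^sup>2) \<le> 2 * cmod (z - \<zeta>) * norm h"
proof (cases "root_kernel z x = 0")
  case False
  let ?g = "root_kernel z x" and ?c = "1 - z * cnj \<zeta>" and ?v = "mat_adj (b z) *v x"
  have z1: "0 < 1 - (cmod z)\<^sup>2" using z by (simp add: power_less_one_iff)
  have c0: "?c \<noteq> 0" using one_minus_mult_cnj_neq_0[of z \<zeta>] z \<zeta> by simp
  have "(norm ?g)\<^sup>2 * (1 - (cmod z)\<^sup>2) = (norm x)\<^sup>2 - (norm ?v)\<^sup>2"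
    using z1 by (simp add: power2_norm_root_kernel[OF z])
  \<comment> \<open>Expansion of the square of \<open>u - ?v\<close>; the equality of the norms of
    \<open>u\<close> and \<open>x\<close> enters here.\<close>
  also have "\<dots> \<le> 2 * ((norm x)\<^sup>2 - inner u ?v)"
  proof -
    have "0 \<le> (norm (u - ?v))\<^sup>2" by simp
    also have "\<dots> = (norm x)\<^sup>2 - 2 * inner u ?v + (norm ?v)\<^sup>2"
      unfolding u[symmetric] power2_norm_eq_inner by (simp add: inner_diff_left inner_diff_right inner_commute)
    finally show ?thesis by simp
  qed
  also have "(norm x)\<^sup>2 - inner u ?v = inner (x - b z *v u) x"
    by (simp add: inner_diff_left inner_mat_left power2_norm_eq_inner)
  \<comment> \<open>Scaling \<open>h\<close> by \<open>?c\<close> cancels the denominator of the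
    boundary kernel. The defect becomes a pairing with \<open>?g\<close>, so one factor
    \<open>norm ?g\<close> can be divided out at the end.\<close>
  also have "x - b z *v u = fun_of (R (cscale ?c h)) z"
    using c0 by (simp add: R_cscale fun_of_cscale[OF z] h[OF z] vector_smult_assoc)
  also have "inner \<dots> x = inner (cscale ?c h) ?g" by (rule inner_root_kernel[OF z, symmetric])
  also have "\<dots> \<le> norm (cscale ?c h) * norm ?g" by (rule norm_cauchy_schwarz)
  finally have "norm ?g * (norm ?g * (1 - (cmod z)\<^sup>2)) \<le> norm ?g * (2 * cmod (z - \<zeta>) * norm h)"
    by (simp add: norm_cscale cmod_one_minus_mult_cnj[OF \<zeta>] power2_eq_square mult_ac)
  with False show ?thesis by simp
qed simp

text \<open>Since \<open>1 - (cmod z)\<^sup>2\<close> is at least \<open>1 - cmod z\<close> and the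
  distance to \<zeta> is at most \<open>t * (1 - cmod z)\<close>, the factor
  \<open>1 - cmod z\<close> cancels.\<close>

lemma root_kernel_bound_stolz:
  assumes \<zeta>: "cmod \<zeta> = 1" and z: "z \<in> stolz t \<zeta>" and t: "t > 1" and u: "norm u = norm x"
    and h: "\<And>z. z \<in> ball 0 1 \<Longrightarrow> fun_of (R h) z = inverse (1 - z * cnj \<zeta>) *s (x - b z *v u)"
  shows "norm (root_kernel z x) \<le> 2 * t * norm h"
proof -
  have zb: "z \<in> ball 0 1" and zt: "cmod (z - \<zeta>) \<le> t * (1 - cmod z)" and z1: "cmod z < 1"
    using z by (auto simp: stolz_def)
  have "norm (root_kernel z x) * (1 - cmod z) \<le> norm (root_kernel z x) * (1 - (cmod z)\<^sup>2)"
    using z1 by (intro mult_left_mono) (auto simp: power2_eq_square mult_left_le)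
  also have "\<dots> \<le> 2 * cmod (z - \<zeta>) * norm h" by (rule root_kernel_bound[OF \<zeta> zb u h])
  also have "\<dots> \<le> 2 * (t * (1 - cmod z)) * norm h" using zt by (intro mult_right_mono) auto
  finally have "(1 - cmod z) * norm (root_kernel z x) \<le> (1 - cmod z) * (2 * t * norm h)"
    by (simp add: mult_ac)
  then show ?thesis using z1 by simp
qed

text \<open>Against root kernels the limit is explicit; boundedness extends it to the closed span.
  The argument runs in each Stolz region separately because the bound grows with
  \<open>t\<close>.\<close>

lemma root_kernel_weak_limit:
  assumes \<zeta>: "cmod \<zeta> = 1" and u: "norm u = norm x"
    and lim: "((\<lambda>z. mat_adj (b z) *v x) \<longlongrightarrow> u) (at_nt \<zeta>)"
    and h: "\<And>z. z \<in> ball 0 1 \<Longrightarrow> fun_of (R h) z = inverse (1 - z * cnj \<zeta>) *s (x - b z *v u)"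
    and v: "v \<in> initial_space"
  shows "((\<lambda>z. inner (root_kernel z x) v) \<longlongrightarrow> inner h v) (at_nt \<zeta>)"
proof (rule tendsto_at_ntI)
  fix t :: real assume t: "t > 1"
  let ?F = "at \<zeta> within stolz t \<zeta>"
  let ?W = "{v. ((\<lambda>z. inner (root_kernel z x) v) \<longlongrightarrow> inner h v) ?F}"
  have "initial_space \<subseteq> ?W"
  proof (rule initial_space_subset)
    show "closed ?W"
      by (rule closed_weak_limit_set[where B = "2 * t * norm h"])
        (rule eventually_mono[OF eventually_at_stolz root_kernel_bound_stolz[OF \<zeta> _ t u h]])
    show "subspace ?W"
      unfolding subspace_def by (auto simp: inner_add_right intro!: tendsto_intros)
    fix w :: complex and e assume w: "w \<in> ball 0 1"
    have "((\<lambda>z. inner (inverse (1 - w * cnj z) *s (x - b w *v (mat_adj (b z) *v x))) e)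
        \<longlongrightarrow> inner (inverse (1 - w * cnj \<zeta>) *s (x - b w *v u)) e) ?F"
      using \<zeta> by (intro tendsto_inner tendsto_const tendsto_kernel w tendsto_ident_at
          tendsto_at_nt_stolz[OF lim t]) auto
    then have "((\<lambda>z. inner (root_kernel z x) (root_kernel w e)) \<longlongrightarrow> inner h (root_kernel w e)) ?F"
      unfolding inner_root_kernel[OF w] h[OF w]
      by (rule Lim_transform_eventually)
        (rule eventually_mono[OF eventually_at_stolz],
          simp add: fun_of_R_root_kernel[OF stolz_subset_ball w])
    then show "root_kernel w e \<in> ?W" by simp
  qed
  with v show "((\<lambda>z. inner (root_kernel z x) v) \<longlongrightarrow> inner h v) ?F" by blast
qed

end

section \<open>Angular derivatives\<close>

lemma mat_adj_mat_adj [simp]: "mat_adj (mat_adj A) = A"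
  by (simp add: mat_adj_def vec_eq_iff)

lemma norm_unitary_adj:
  assumes "unitary_mat \<alpha>"
  shows "norm (mat_adj \<alpha> *v x) = norm x"
proof -
  have "(norm (mat_adj \<alpha> *v x))\<^sup>2 = (norm x)\<^sup>2"
    using assms by (simp add: power2_norm_eq_inner inner_mat_left matrix_vector_mul_assoc unitary_mat_def)
  then show ?thesis by (rule power2_eq_imp_eq) auto
qed

lemma subspace_if_vec_subspace:
  fixes E :: "(complex ^ 'n) set"
  assumes "vec.subspace E"
  shows "subspace E"
proof -
  have "c *\<^sub>R x = of_real c *s x" for c and x :: "complex ^ 'n"
    by (simp add: vec_eq_iff scaleR_conv_of_real[where 'a = complex])
  then show ?thesis using assms by (simp add: subspace_def vec.subspace_def)
qed

text \<open>\<open>orth_proj\<close> is a definite description, so existence and uniqueness are both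
  required. The real orthogonal decomposition suffices: for a complex subspace, real orthogonality
  already implies complex orthogonality.\<close>

lemma orth_proj_works:
  fixes E :: "(complex ^ 'n) set"
  assumes E: "vec.subspace E"
  shows "orth_proj E ** orth_proj E = orth_proj E \<and> mat_adj (orth_proj E) = orth_proj E \<and>
    range ((*v) (orth_proj E)) = E"
proof -
  have spanE: "span E = E" using subspace_if_vec_subspace[OF E] span_eq_iff by blast
  have "\<forall>x. \<exists>u. u \<in> E \<and> (\<forall>w\<in>E. inner (x - u) w = 0)"
  proof
    fix x
    obtain y z where "y \<in> span E" "\<And>w. w \<in> span E \<Longrightarrow> orthogonal z w" "x = y + z"
      using orthogonal_subspace_decomp_exists[of E x] by blast
    then show "\<exists>u. u \<in> E \<and> (\<forall>w\<in>E. inner (x - u) w = 0)"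
      unfolding spanE by (intro exI[of _ y]) (auto simp: orthogonal_def)
  qed
  from choice[OF this] obtain p where p: "\<And>x. p x \<in> E" "\<And>x w. w \<in> E \<Longrightarrow> inner (x - p x) w = 0"
    by blast
  \<comment> \<open>This characterization of \<open>p x\<close> yields additivity, complex
    homogeneity and, later, uniqueness of the projection matrix.\<close>
  have uniq: "u = p x" if "u \<in> E" "\<And>w. w \<in> E \<Longrightarrow> inner (x - u) w = 0" for u x
  proof -
    have d: "u - p x \<in> E" using vec.subspace_diff[OF E that(1) p(1)] .
    have "inner (u - p x) (u - p x) = inner (x - p x) (u - p x) - inner (x - u) (u - p x)"
      by (simp add: inner_diff_left)
    then have "inner (u - p x) (u - p x) = 0" using that(2)[OF d] p(2)[OF d] by simp
    then show ?thesis by simp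
  qed
  have p_add: "p (x + y) = p x + p y" for x y
  proof -
    have "inner ((x + y) - (p x + p y)) w = 0" if "w \<in> E" for w
      using p(2)[OF that, of x] p(2)[OF that, of y] by (simp add: inner_diff_left inner_add_left)
    from uniq[OF vec.subspace_add[OF E p(1) p(1)] this] show ?thesis by simp
  qed
  have p_smult: "p (c *s x) = c *s p x" for c x
  proof -
    have "inner (c *s x - c *s p x) w = 0" if "w \<in> E" for w
      using p(2)[OF vec.subspace_scale[OF E that, of "cnj c"], of x]
      by (simp only: vector_ssub_ldistrib[symmetric] inner_smult_left)
    from uniq[OF vec.subspace_scale[OF E p(1)] this] show ?thesis by simp
  qed
  have lin: "Vector_Spaces.linear (*s) (*s) p"
    unfolding Vector_Spaces.linear_iff using p_add p_smult vec.vector_space_axioms by blast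
  define P where "P = matrix p"
  have Pp: "P *v x = p x" for x unfolding P_def by (rule matrix_works[OF lin])
  have pE: "p x = x" if "x \<in> E" for x using uniq[OF that, of x] by simp
  have sym: "inner (p x) y = inner x (p y)" for x y
    using p(2)[OF p(1)[of x], of y] p(2)[OF p(1)[of y], of x]
    by (simp add: inner_diff_left inner_diff_right inner_commute)
  have 1: "P ** P = P"
    unfolding matrix_eq by (simp add: matrix_vector_mul_assoc[symmetric] Pp pE p(1))
  have 2: "mat_adj P = P"
  proof -
    have "inner y (mat_adj P *v x) = inner y (P *v x)" for x y
      by (simp add: inner_mat_left[symmetric] Pp sym)
    then show ?thesis unfolding matrix_eq using vector_eq_ldot by blast
  qed
  have 3: "range ((*v) P) = E"
  proof (intro equalityI subsetI)
    fix x assume "x \<in> E"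
    then have "x = P *v x" by (simp add: Pp pE)
    then show "x \<in> range ((*v) P)" by blast
  qed (auto simp: Pp p(1))
  \<comment> \<open>A self-adjoint idempotent with range \<open>E\<close> leaves a residual
    \<open>x - Q *v x\<close> orthogonal to \<open>E\<close>, so it satisfies the characterization
    of \<open>p\<close>.\<close>
  have 4: "Q = P" if Q: "Q ** Q = Q \<and> mat_adj Q = Q \<and> range ((*v) Q) = E" for Q
    unfolding matrix_eq
  proof
    fix x
    have "inner (x - Q *v x) w = 0" if wE: "w \<in> E" for w
    proof -
      obtain v where w: "w = Q *v v" using Q wE by blast
      have "inner (x - Q *v x) w = inner (Q *v (x - Q *v x)) v"
        using Q by (simp add: w inner_mat_left)
      also have "Q *v (x - Q *v x) = 0"
        using Q by (simp add: matrix_vector_mult_diff_distrib matrix_vector_mul_assoc)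
      finally show ?thesis by simp
    qed
    moreover have "Q *v x \<in> E" using Q by blast
    ultimately show "Q *v x = P *v x" unfolding Pp by (intro uniq)
  qed
  have "\<exists>!P. P ** P = P \<and> mat_adj P = P \<and> range ((*v) P) = E"
  proof (rule ex1I[of _ P])
    show "P ** P = P \<and> mat_adj P = P \<and> range ((*v) P) = E" using 1 2 3 by blast
  qed (rule 4)
  from theI'[OF this] show ?thesis unfolding orth_proj_def .
qed

lemma mat_deriv_cinner:
  fixes f :: "complex \<Rightarrow> complex ^ 'n ^ 'm"
  assumes "\<And>i j. (\<lambda>w. f w $ i $ j) holomorphic_on ball 0 1" "z \<in> ball 0 1"
  shows "((\<lambda>w. cinner (f w *v x) y) has_field_derivative cinner (mat_deriv f z *v x) y) (at z)"
proof -
  have d: "((\<lambda>w. f w $ i $ j) has_field_derivative mat_deriv f z $ i $ j) (at z)" for i j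
    using holomorphic_derivI[OF assms(1) open_ball assms(2)] by (simp add: mat_deriv_def)
  show ?thesis
    unfolding cinner_def matrix_vector_mult_def
    by (auto intro!: derivative_eq_intros d)
qed

text \<open>Cauchy's estimate on discs of radius \<open>(1 - \<bar>z\<bar>)/2\<close>, which stay in a larger Stolz region.\<close>

lemma nt_limit_deriv:
  fixes \<phi> :: "complex \<Rightarrow> complex"
  assumes \<zeta>: "cmod \<zeta> = 1" and hol: "\<phi> holomorphic_on ball 0 1"
    and lim: "(\<phi> \<longlongrightarrow> c) (at_nt \<zeta>)"
  shows "((\<lambda>z. (1 - z * cnj \<zeta>) * deriv \<phi> z) \<longlongrightarrow> 0) (at_nt \<zeta>)"
proof (rule tendsto_at_ntI)
  fix t :: real assume t: "t > 1"
  show "((\<lambda>z. (1 - z * cnj \<zeta>) * deriv \<phi> z) \<longlongrightarrow> 0) (at \<zeta> within stolz t \<zeta>)"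
  proof (rule tendstoI)
    fix e :: real assume e: "e > 0"
    \<comment> \<open>Cauchy's estimate will give the bound
      \<open>t * (2 * \<rho>) * (e' / \<rho>)\<close>, which is then \<open>e / 2\<close>.\<close>
    define e' where "e' = e / (4 * t)"
    have e': "e' > 0" using e t by (simp add: e'_def)
    \<comment> \<open>On the disc of radius \<rho> about \<open>z\<close> the distance to \<zeta> is
      below \<open>\<rho> + 2 * t * \<rho>\<close>, while \<open>1 - cmod w\<close> is at least
      \<rho>; hence the aperture \<open>2 * t + 1\<close>.\<close>
    have "(\<phi> \<longlongrightarrow> c) (at \<zeta> within stolz (2 * t + 1) \<zeta>)"
      using tendsto_at_nt_stolz[OF lim, of "2 * t + 1"] t by simp
    from tendstoD[OF this e'] obtain d where d: "d > 0"
      "\<And>w. w \<in> stolz (2 * t + 1) \<zeta> \<Longrightarrow> w \<noteq> \<zeta> \<Longrightarrow> dist w \<zeta> < d \<Longrightarrow> dist (\<phi> w) c < e'"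
      unfolding eventually_at by blast
    have "dist ((1 - z * cnj \<zeta>) * deriv \<phi> z) 0 < e"
      if z: "z \<in> stolz t \<zeta>" and zd: "dist z \<zeta> < d / 2" for z
    proof -
      define \<rho> where "\<rho> = (1 - cmod z) / 2"
      have z1: "cmod z < 1" and zt: "cmod (z - \<zeta>) < t * (1 - cmod z)"
        using z by (auto simp: stolz_def)
      have \<rho>2: "2 * \<rho> = 1 - cmod z" by (simp add: \<rho>_def)
      have \<rho>: "\<rho> > 0" using z1 by (simp add: \<rho>_def)
      \<comment> \<open>The radius is at most half the distance from \<open>z\<close> to \<zeta>, so
        requiring this distance to be below \<open>d / 2\<close> keeps the whole disc within
        \<open>d\<close> of \<zeta>.\<close>
      have \<rho>z: "2 * \<rho> \<le> cmod (z - \<zeta>)"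
        using \<zeta> norm_triangle_ineq2[of \<zeta> z] by (simp add: \<rho>_def norm_minus_commute)
      have near: "cmod w < 1 \<and> cmod (\<phi> w - c) \<le> e'" if w: "cmod (z - w) \<le> \<rho>" for w
      proof -
        have w1: "1 - cmod w \<ge> \<rho>"
          using w norm_triangle_ineq2[of w z] by (simp add: \<rho>_def norm_minus_commute)
        have wz: "cmod (w - \<zeta>) \<le> \<rho> + cmod (z - \<zeta>)"
          using w norm_triangle_ineq[of "w - z" "z - \<zeta>"] by (simp add: norm_minus_commute)
        also have "\<dots> < \<rho> + t * (2 * \<rho>)" using zt unfolding \<rho>2 by simp
        also have "\<dots> = (2 * t + 1) * \<rho>" by (simp add: algebra_simps)
        also have "\<dots> \<le> (2 * t + 1) * (1 - cmod w)" using w1 t by (intro mult_left_mono) auto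
        finally have "w \<in> stolz (2 * t + 1) \<zeta>" using w1 \<rho> by (simp add: stolz_def)
        moreover have "dist w \<zeta> < d"
          using wz \<rho>z zd \<rho> by (simp add: dist_norm)
        moreover have "w \<noteq> \<zeta>" using w1 \<rho> \<zeta> by auto
        ultimately show ?thesis using d(2)[of w] w1 \<rho> by (simp add: dist_norm)
      qed
      have sub: "cball z \<rho> \<subseteq> ball 0 1" using near by (auto simp: dist_norm)
      have "norm ((deriv ^^ 1) (\<lambda>w. \<phi> w - c) z) \<le> fact 1 * e' / \<rho> ^ 1"
      proof (rule Cauchy_inequality)
        show "(\<lambda>w. \<phi> w - c) holomorphic_on ball z \<rho>"
          using sub by (intro holomorphic_intros holomorphic_on_subset[OF hol]) auto
        show "continuous_on (cball z \<rho>) (\<lambda>w. \<phi> w - c)"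
          by (intro continuous_intros continuous_on_subset[OF holomorphic_on_imp_continuous_on[OF hol] sub])
      qed (use \<rho> near in auto)
      moreover have "deriv (\<lambda>w. \<phi> w - c) z = deriv \<phi> z"
      proof -
        have "\<phi> field_differentiable at z"
          using holomorphic_on_imp_differentiable_at[OF hol open_ball, of z] z1 by simp
        then show ?thesis by simp
      qed
      ultimately have dz: "cmod (deriv \<phi> z) \<le> e' / \<rho>" by simp
      have "cmod ((1 - z * cnj \<zeta>) * deriv \<phi> z) = cmod (z - \<zeta>) * cmod (deriv \<phi> z)"
        by (simp add: norm_mult cmod_one_minus_mult_cnj[OF \<zeta>])
      also have "\<dots> \<le> (t * (2 * \<rho>)) * (e' / \<rho>)"
        using zt z1 \<rho> t by (intro mult_mono dz) (auto simp: \<rho>2)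
      also have "\<dots> < e" using \<rho> t e by (simp add: e'_def)
      finally show ?thesis by simp
    qed
    then show "\<forall>\<^sub>F z in at \<zeta> within stolz t \<zeta>. dist ((1 - z * cnj \<zeta>) * deriv \<phi> z) 0 < e"
      unfolding eventually_at using d(1) by (intro exI[of _ "d / 2"]) auto
  qed
qed

lemma schur_class_mult_unitary:
  assumes b: "b \<in> schur_class" and \<alpha>: "unitary_mat \<alpha>"
  shows "(\<lambda>z. b z ** mat_adj \<alpha>) \<in> schur_class"
proof -
  have "(\<lambda>z. (b z ** mat_adj \<alpha>) $ i $ j) holomorphic_on ball 0 1" for i j
    using b unfolding matrix_matrix_mult_def schur_class_def by (auto intro!: holomorphic_intros)
  moreover have "onorm ((*v) (b z ** mat_adj \<alpha>)) < 1" if z: "z \<in> ball 0 1" for z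
  proof -
    have "onorm ((*v) (b z) \<circ> (*v) (mat_adj \<alpha>)) \<le> onorm ((*v) (b z)) * onorm ((*v) (mat_adj \<alpha>))"
      by (intro onorm_compose matrix_vector_mul_bounded_linear)
    also have "\<dots> \<le> onorm ((*v) (b z)) * 1"
      by (intro mult_left_mono onorm_le onorm_pos_le matrix_vector_mul_bounded_linear)
        (simp add: norm_unitary_adj[OF \<alpha>])
    also have "\<dots> < 1" using b z by (simp add: schur_class_def)
    finally show ?thesis by (simp add: o_def matrix_vector_mul_assoc)
  qed
  ultimately show ?thesis by (simp add: schur_class_def)
qed

section \<open>The directional space and the limit of the derivative\<close>

context schur_function
begin

text \<open>The Caratheodory sequence stays in one Stolz region, so the limit defining
  \<open>dir_S\<close> holds along it and identifies the boundary value in the kernel.\<close>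

lemma dir_E_boundary_vector:
  assumes \<zeta>: "cmod \<zeta> = 1" and x: "x \<in> dir_E b \<alpha> \<zeta>"
  obtains h where "h \<in> initial_space"
    "\<And>z. z \<in> ball 0 1 \<Longrightarrow> fun_of (R h) z = inverse (1 - z * cnj \<zeta>) *s (x - b z *v (mat_adj \<alpha> *v x))"
proof -
  have lim: "((\<lambda>z. mat_adj (b z) *v x) \<longlongrightarrow> mat_adj \<alpha> *v x) (at_nt \<zeta>)" and cc: "caratheodory_cond b \<zeta> x"
    using x by (auto simp: dir_E_def dir_S_def)
  obtain t B Z where Z: "t > 1" "\<And>n::nat. Z n \<in> stolz t \<zeta>" "\<And>n. Z n \<noteq> \<zeta>" "Z \<longlonglongrightarrow> \<zeta>"
    "\<And>n. julia_quotient b x (Z n) \<le> B"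
    using caratheodory_cond_sequence[OF cc] by blast
  have "filterlim Z (at \<zeta> within stolz t \<zeta>) sequentially"
    using Z by (simp add: filterlim_at)
  then have "(\<lambda>n. mat_adj (b (Z n)) *v x) \<longlonglongrightarrow> mat_adj \<alpha> *v x"
    using filterlim_compose[OF tendsto_at_nt_stolz[OF lim Z(1)]] by blast
  from boundary_vector_exists[OF \<zeta> stolz_subset_ball[OF Z(2)] Z(4) Z(5) this] that
  show thesis by blast
qed

text \<open>Two directions may satisfy the liminf condition along unrelated sequences. Julia's
  inequality replaces both by norm bounds on the same Stolz region, which add; the aperture 2 is an
  arbitrary choice.\<close>

lemma vec_subspace_dir_E:
  assumes \<zeta>: "cmod \<zeta> = 1" and \<alpha>: "unitary_mat \<alpha>"
  shows "vec.subspace (dir_E b \<alpha> \<zeta>)"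
proof -
  have bound: "\<exists>B. \<forall>z\<in>stolz 2 \<zeta>. norm (root_kernel z x) \<le> B" if x: "x \<in> dir_E b \<alpha> \<zeta>" for x
  proof -
    obtain h where h: "\<And>z. z \<in> ball 0 1 \<Longrightarrow> fun_of (R h) z = inverse (1 - z * cnj \<zeta>) *s (x - b z *v (mat_adj \<alpha> *v x))"
      using dir_E_boundary_vector[OF \<zeta> x] by blast
    show ?thesis
      using root_kernel_bound_stolz[OF \<zeta> _ _ norm_unitary_adj[OF \<alpha>] h, of _ 2] by auto
  qed
  \<comment> \<open>The quotient in the condition is the square of this norm, hence
    \<open>B\<^sup>2\<close>.\<close>
  have condI: "caratheodory_cond b \<zeta> x" if "\<And>z. z \<in> stolz 2 \<zeta> \<Longrightarrow> norm (root_kernel z x) \<le> B" for x B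
  proof (rule caratheodory_condI[OF \<zeta>, of 2 _ _ "B\<^sup>2"])
    show "\<forall>\<^sub>F z in at \<zeta> within stolz 2 \<zeta>. julia_quotient b x z \<le> B\<^sup>2"
      by (rule eventually_mono[OF eventually_at_stolz])
        (auto simp: julia_quotient_eq[OF stolz_subset_ball] intro!: power_mono that)
  qed simp
  show ?thesis
    unfolding vec.subspace_def
  proof (intro conjI ballI allI)
    have "root_kernel z 0 = 0" for z using cscale_root_kernel[of 0 z 0] cscale_of_real[of 0 "root_kernel z 0"] by simp
    then show "0 \<in> dir_E b \<alpha> \<zeta>"
      by (auto simp: dir_E_def dir_S_def intro!: condI[of 0 0])
  next
    fix x y assume xy: "x \<in> dir_E b \<alpha> \<zeta>" "y \<in> dir_E b \<alpha> \<zeta>"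
    obtain B C where B: "\<And>z. z \<in> stolz 2 \<zeta> \<Longrightarrow> norm (root_kernel z x) \<le> B"
      and C: "\<And>z. z \<in> stolz 2 \<zeta> \<Longrightarrow> norm (root_kernel z y) \<le> C"
      using bound[OF xy(1)] bound[OF xy(2)] by blast
    have "caratheodory_cond b \<zeta> (x + y)"
      by (rule condI[of _ "B + C"]) (use B C in \<open>simp add: root_kernel_add norm_triangle_le add_mono\<close>)
    then show "x + y \<in> dir_E b \<alpha> \<zeta>"
      using xy by (auto simp: dir_E_def dir_S_def matrix_vector_right_distrib intro: tendsto_add)
  next
    fix x and c :: complex assume x: "x \<in> dir_E b \<alpha> \<zeta>"
    obtain B where B: "\<And>z. z \<in> stolz 2 \<zeta> \<Longrightarrow> norm (root_kernel z x) \<le> B"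
      using bound[OF x] by blast
    have "caratheodory_cond b \<zeta> (c *s x)"
      by (rule condI[of _ "cmod c * B"])
        (use B in \<open>simp add: cscale_root_kernel[symmetric] norm_cscale mult_left_mono\<close>)
    then show "c *s x \<in> dir_E b \<alpha> \<zeta>"
      using x by (auto simp: dir_E_def dir_S_def vector_scalar_commute intro: tendsto_vec_smult tendsto_const)
  qed
qed

lemma bdry_kernel_eq:
  assumes \<zeta>: "cmod \<zeta> = 1" and x: "x \<in> dir_E b \<alpha> \<zeta>"
  shows "bdry_kernel b \<zeta> x z = inverse (1 - z * cnj \<zeta>) *s (x - b z *v (mat_adj \<alpha> *v x))"
proof -
  have "bdry_adj b \<zeta> x = mat_adj \<alpha> *v x"
    unfolding bdry_adj_def using x by (intro tendsto_Lim at_nt_neq_bot \<zeta>) (simp add: dir_E_def dir_S_def)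
  then show ?thesis by (simp add: bdry_kernel_def)
qed

text \<open>Convergence of the adjoints is turned into convergence of \<open>b\<close> itself: since
  \<open>b(z)\<close> is a contraction, the squared distance is at most twice
  \<open>(norm x)\<^sup>2 - inner ?u (mat_adj (b z) *v x)\<close>, and this vanishes in the limit
  because \<open>?u\<close> has the norm of \<open>x\<close>.\<close>

lemma nt_limit_mult_unitary:
  assumes \<zeta>: "cmod \<zeta> = 1" and \<alpha>: "unitary_mat \<alpha>" and x: "x \<in> dir_E b \<alpha> \<zeta>"
  shows "((\<lambda>z. (b z ** mat_adj \<alpha>) *v x) \<longlongrightarrow> x) (at_nt \<zeta>)"
proof -
  let ?u = "mat_adj \<alpha> *v x"
  have lim: "((\<lambda>z. mat_adj (b z) *v x) \<longlongrightarrow> ?u) (at_nt \<zeta>)" using x by (auto simp: dir_E_def dir_S_def)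
  have nu: "norm ?u = norm x" by (rule norm_unitary_adj[OF \<alpha>])
  have "((\<lambda>z. 2 * (norm x)\<^sup>2 - 2 * inner ?u (mat_adj (b z) *v x)) \<longlongrightarrow> 2 * (norm x)\<^sup>2 - 2 * inner ?u ?u) (at_nt \<zeta>)"
    by (intro tendsto_intros lim)
  then have lim0: "((\<lambda>z. 2 * (norm x)\<^sup>2 - 2 * inner ?u (mat_adj (b z) *v x)) \<longlongrightarrow> 0) (at_nt \<zeta>)"
    unfolding power2_norm_eq_inner[symmetric] nu by simp
  have le: "(norm (b z *v ?u - x))\<^sup>2 \<le> 2 * (norm x)\<^sup>2 - 2 * inner ?u (mat_adj (b z) *v x)"
    if z: "z \<in> ball 0 1" for z
  proof -
    have "(norm (b z *v ?u))\<^sup>2 \<le> (norm x)\<^sup>2"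
      using schur_class_contraction[OF schur z, of ?u] nu by (intro power_mono) auto
    moreover have "(norm (b z *v ?u - x))\<^sup>2 = (norm (b z *v ?u))\<^sup>2 - 2 * inner ?u (mat_adj (b z) *v x) + (norm x)\<^sup>2"
      unfolding inner_mat_left[symmetric] power2_norm_eq_inner
      by (simp add: inner_diff_left inner_diff_right inner_commute)
    ultimately show ?thesis by simp
  qed
  have "((\<lambda>z. (norm (b z *v ?u - x))\<^sup>2) \<longlongrightarrow> 0) (at_nt \<zeta>)"
    by (rule tendsto_sandwich[OF _ eventually_mono[OF eventually_at_nt_ball le] tendsto_const lim0]) auto
  from tendsto_real_sqrt[OF this] have "((\<lambda>z. norm (b z *v ?u - x)) \<longlongrightarrow> 0) (at_nt \<zeta>)" by simp
  then show ?thesis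
    by (simp add: tendsto_norm_zero_iff Lim_null[symmetric] matrix_vector_mul_assoc[symmetric])
qed

text \<open>With \<open>\<phi>(z) = \<langle>(x - b(z)\<alpha>\<^sup>*x) / (1 - z cnj \<zeta>), y\<rangle>\<close> one has
  \<open>\<langle>b(z)\<alpha>\<^sup>*x, y\<rangle> = \<langle>x, y\<rangle> - (1 - z cnj \<zeta>) \<phi>(z)\<close>; now differentiate.\<close>

lemma nt_limit_derivative:
  assumes \<zeta>: "cmod \<zeta> = 1" and \<alpha>: "unitary_mat \<alpha>" and x: "x \<in> dir_E b \<alpha> \<zeta>" and y: "y \<in> dir_E b \<alpha> \<zeta>"
  shows "((\<lambda>z. cinner (mat_deriv (\<lambda>z. b z ** mat_adj \<alpha>) z *v x) y)
    \<longlongrightarrow> cnj \<zeta> * dBR_inner b (bdry_kernel b \<zeta> x) (bdry_kernel b \<zeta> y)) (at_nt \<zeta>)"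
proof -
  define \<beta> where "\<beta> = (\<lambda>z. b z ** mat_adj \<alpha>)"
  obtain h where h: "h \<in> initial_space"
    "\<And>z. z \<in> ball 0 1 \<Longrightarrow> fun_of (R h) z = inverse (1 - z * cnj \<zeta>) *s (x - b z *v (mat_adj \<alpha> *v x))"
    using dir_E_boundary_vector[OF \<zeta> x] by blast
  obtain k where k: "k \<in> initial_space"
    "\<And>z. z \<in> ball 0 1 \<Longrightarrow> fun_of (R k) z = inverse (1 - z * cnj \<zeta>) *s (y - b z *v (mat_adj \<alpha> *v y))"
    using dir_E_boundary_vector[OF \<zeta> y] by blast
  define c where "c = dBR_inner b (bdry_kernel b \<zeta> x) (bdry_kernel b \<zeta> y)"
  have c_eq: "c = Complex (inner h k) (inner h (cscale \<i> k))"
    unfolding c_def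
    by (rule dBR_inner_eq[OF h(1) k(1)])
      (use h(2) k(2) in \<open>simp_all add: eq_on_disc_def bdry_kernel_eq[OF \<zeta> x] bdry_kernel_eq[OF \<zeta> y]\<close>)
  define \<phi> where "\<phi> z = cinner (fun_of (R h) z) y" for z
  have hol: "\<phi> holomorphic_on ball 0 1"
    unfolding \<phi>_def cinner_def by (intro holomorphic_intros fun_of_holomorphic)
  \<comment> \<open>The weak limit is taken for the kernels in direction \<open>y\<close>; the
    vector \<open>h\<close> of direction \<open>x\<close> serves as the test vector.\<close>
  have weak: "((\<lambda>z. inner v (root_kernel z y)) \<longlongrightarrow> inner v k) (at_nt \<zeta>)" if "v \<in> initial_space" for v
    using root_kernel_weak_limit[OF \<zeta> norm_unitary_adj[OF \<alpha>] _ k(2) that] y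
    by (simp add: dir_E_def dir_S_def inner_commute)
  have \<phi>_lim: "(\<phi> \<longlongrightarrow> c) (at_nt \<zeta>)"
  proof (rule Lim_transform_eventually)
    show "\<forall>\<^sub>F z in at_nt \<zeta>. Complex (inner h (root_kernel z y)) (inner (cscale (- \<i>) h) (root_kernel z y)) = \<phi> z"
    proof (rule eventually_mono[OF eventually_at_nt_ball])
      fix z :: complex assume z: "z \<in> ball 0 1"
      \<comment> \<open>For the imaginary part, \<i> is moved from the kernel to \<open>h\<close>,
        so the weak limit in direction \<open>y\<close> covers both parts.\<close>
      have "inner (cscale (- \<i>) h) (root_kernel z y) = inner h (root_kernel z (\<i> *s y))"
        unfolding inner_cscale_left cscale_root_kernel by simp
      then show "Complex (inner h (root_kernel z y)) (inner (cscale (- \<i>) h) (root_kernel z y)) = \<phi> z"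
        by (simp add: \<phi>_def cinner_eq_Complex inner_root_kernel[OF z])
    qed
    have "inner (cscale (- \<i>) h) k = inner h (cscale \<i> k)" by (simp add: inner_cscale_left)
    then show "((\<lambda>z. Complex (inner h (root_kernel z y)) (inner (cscale (- \<i>) h) (root_kernel z y))) \<longlongrightarrow> c) (at_nt \<zeta>)"
      unfolding c_eq using weak[OF h(1)] weak[OF cscale_in_initial_space[OF h(1), of "- \<i>"]]
      by (intro tendsto_Complex) simp_all
  qed
  have eq: "cinner (mat_deriv \<beta> z *v x) y = cnj \<zeta> * \<phi> z - (1 - z * cnj \<zeta>) * deriv \<phi> z"
    if z: "z \<in> ball 0 1" for z
  proof (rule DERIV_unique)
    show "((\<lambda>w. cinner (\<beta> w *v x) y) has_field_derivative cinner (mat_deriv \<beta> z *v x) y) (at z)"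
      using schur_class_mult_unitary[OF schur \<alpha>] unfolding \<beta>_def
      by (intro mat_deriv_cinner z) (simp add: schur_class_def)
    have d: "((\<lambda>w. cinner x y - (1 - w * cnj \<zeta>) * \<phi> w) has_field_derivative
        cnj \<zeta> * \<phi> z - (1 - z * cnj \<zeta>) * deriv \<phi> z) (at z)"
      by (rule derivative_eq_intros holomorphic_derivI[OF hol open_ball z] refl | simp)+
    have e: "cinner x y - (1 - w * cnj \<zeta>) * \<phi> w = cinner (\<beta> w *v x) y" if w: "w \<in> ball 0 1" for w
    proof -
      have "1 - w * cnj \<zeta> \<noteq> 0" using one_minus_mult_cnj_neq_0[of w \<zeta>] w \<zeta> by simp
      then have "(1 - w * cnj \<zeta>) * \<phi> w = cinner (x - b w *v (mat_adj \<alpha> *v x)) y"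
        unfolding \<phi>_def h(2)[OF w] cinner_smult_left mult.assoc[symmetric] by simp
      then show ?thesis by (simp add: cinner_diff_left \<beta>_def matrix_vector_mul_assoc[symmetric])
    qed
    show "((\<lambda>w. cinner (\<beta> w *v x) y) has_field_derivative
        cnj \<zeta> * \<phi> z - (1 - z * cnj \<zeta>) * deriv \<phi> z) (at z)"
      by (rule has_field_derivative_transform_within_open[OF d open_ball z e])
  qed
  \<comment> \<open>The term with \<open>deriv \<phi>\<close> vanishes by Cauchy's estimate; the
    factor \<open>cnj \<zeta>\<close> that remains comes from differentiating
    \<open>1 - z * cnj \<zeta>\<close>.\<close>
  have "((\<lambda>z. cnj \<zeta> * \<phi> z - (1 - z * cnj \<zeta>) * deriv \<phi> z) \<longlongrightarrow> cnj \<zeta> * c - 0) (at_nt \<zeta>)"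
    by (intro tendsto_intros \<phi>_lim nt_limit_deriv[OF \<zeta> hol \<phi>_lim])
  then show ?thesis
    unfolding c_def[symmetric] \<beta>_def[symmetric] diff_0_right
    by (rule Lim_transform_eventually) (rule eventually_mono[OF eventually_at_nt_ball], simp only: eq)
qed

end

theorem theorem8p1:
  fixes b :: "complex \<Rightarrow> complex ^ 'n ^ 'n"
    and \<alpha> :: "complex ^ 'n ^ 'n"
    and \<zeta> :: complex
    and E :: "(complex ^ 'n) set"
  assumes "b \<in> schur_class"
    and "unitary_mat \<alpha>"
    and "\<zeta> \<in> sphere 0 1"
    and "E = dir_E b \<alpha> \<zeta>"
  shows "has_CAD E (\<lambda>z. b z ** mat_adj \<alpha>) \<zeta> \<and>
         (\<forall>x\<in>E. \<forall>y\<in>E.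
            \<zeta> * cinner (CAD E (\<lambda>z. b z ** mat_adj \<alpha>) \<zeta> *v x) y =
            dBR_inner b (bdry_kernel b \<zeta> x) (bdry_kernel b \<zeta> y))"
proof -
  interpret schur_function b by unfold_locales (rule assms(1))
  note \<alpha> = assms(2)
  have \<zeta>: "cmod \<zeta> = 1" using assms(3) by simp
  have E: "vec.subspace E" unfolding assms(4) by (rule vec_subspace_dir_E[OF \<zeta> \<alpha>])
  define \<beta> where "\<beta> = (\<lambda>z. b z ** mat_adj \<alpha>)"
  define P where "P = orth_proj E"
  define c where "c x y = cnj \<zeta> * dBR_inner b (bdry_kernel b \<zeta> x) (bdry_kernel b \<zeta> y)" for x y
  have P: "P ** P = P" "mat_adj P = P" "range ((*v) P) = E"
    using orth_proj_works[OF E] by (auto simp: P_def)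
  have PE: "P *v x \<in> E" for x using P(3) by blast
  have PxE: "P *v x = x" if x: "x \<in> E" for x
  proof -
    obtain v where "x = P *v v" using P(3) x by blast
    then show ?thesis by (simp add: matrix_vector_mul_assoc P(1))
  qed
  have lim: "((\<lambda>z. cinner (mat_deriv \<beta> z *v x) y) \<longlongrightarrow> c x y) (at_nt \<zeta>)" if "x \<in> E" "y \<in> E" for x y
    using nt_limit_derivative[OF \<zeta> \<alpha>, of x y] that by (simp add: assms(4) \<beta>_def c_def)
  have compress: "cinner ((P ** A ** P) *v x) y = cinner (A *v (P *v x)) (P *v y)" for A x y
    by (simp add: matrix_vector_mul_assoc[symmetric] cinner_mat_left P(2))
  have entry: "A $ i $ j = cinner (A *v axis j 1) (axis i 1)" for A :: "complex ^ 'n ^ 'n" and i j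
    by (simp add: cinner_def axis_def matrix_vector_mult_def if_distrib[where f = "\<lambda>x. _ * x"]
        if_distrib[where f = cnj] cong: if_cong)
  \<comment> \<open>The entries of the compressed matrix are values of the form at the vectors
    \<open>P *v axis j 1\<close> and \<open>P *v axis i 1\<close>. These lie in \<open>E\<close>, so
    the scalar limits determine the matrix limit.\<close>
  define L where "L = (\<chi> i j. c (P *v axis j 1) (P *v axis i 1))"
  have conv: "((\<lambda>z. P ** mat_deriv \<beta> z ** P) \<longlongrightarrow> L) (at_nt \<zeta>)"
  proof (intro vec_tendstoI)
    fix i j
    show "((\<lambda>z. (P ** mat_deriv \<beta> z ** P) $ i $ j) \<longlongrightarrow> L $ i $ j) (at_nt \<zeta>)"
      unfolding entry[of "P ** _ ** P"] compress L_def by (simp add: lim PE)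
  qed
  have CAD: "CAD E \<beta> \<zeta> = L"
    unfolding CAD_def P_def[symmetric] by (rule tendsto_Lim[OF at_nt_neq_bot[OF \<zeta>] conv])
  have "has_CAD E \<beta> \<zeta>"
    unfolding has_CAD_def P_def[symmetric]
  proof (intro conjI ballI)
    show "\<beta> \<in> schur_class" unfolding \<beta>_def by (rule schur_class_mult_unitary[OF assms(1) \<alpha>])
    show "((\<lambda>z. \<beta> z *v e) \<longlongrightarrow> e) (at_nt \<zeta>)" if "e \<in> E" for e
      unfolding \<beta>_def using that by (intro nt_limit_mult_unitary[OF \<zeta> \<alpha>]) (simp add: assms(4))
  qed (use E conv in blast)+
  moreover have "\<zeta> * cinner (L *v x) y = dBR_inner b (bdry_kernel b \<zeta> x) (bdry_kernel b \<zeta> y)"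
    if xy: "x \<in> E" "y \<in> E" for x y
  proof -
    have "((\<lambda>z. cinner ((P ** mat_deriv \<beta> z ** P) *v x) y) \<longlongrightarrow> cinner (L *v x) y) (at_nt \<zeta>)"
      unfolding cinner_def matrix_vector_mult_def
      by (simp, intro tendsto_intros tendsto_vec_nth conv)
    moreover have "((\<lambda>z. cinner ((P ** mat_deriv \<beta> z ** P) *v x) y) \<longlongrightarrow> c x y) (at_nt \<zeta>)"
      unfolding compress using lim[OF xy] xy by (simp add: PxE)
    ultimately have "cinner (L *v x) y = c x y"
      using tendsto_unique[OF at_nt_neq_bot[OF \<zeta>]] by blast
    \<comment> \<open>The factor \<zeta> in the claim cancels the \<open>cnj \<zeta>\<close>
      produced by the differentiation.\<close>
    moreover have "\<zeta> * cnj \<zeta> = 1" using \<zeta> complex_norm_square[of \<zeta>] by simp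
    ultimately show ?thesis by (simp add: c_def mult.assoc[symmetric])
  qed
  ultimately show ?thesis by (simp add: CAD \<beta>_def[symmetric])
qed

end
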